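(* Let $(\xi_1,\xi_2)$ be a random vector in $\mathbb{R}^2$ and $\zeta$ a real random variable such that $\xi_1,\xi_2$ each have mean zero and unit variance, $\zeta$ has mean zero and variance $\sigma^2$, and $\mathbb{E}|\xi_1|^{6+\tau}+\mathbb{E}|\xi_2|^{6+\tau}+\mathbb{E}|\zeta|^{4+\tau}<\infty$ for some $\tau>0$. For each $N\ge 1$, let $\mathbf{Y}_N$ be an $N\times N$ real elliptic random matrix with atom variables $(\xi_1,\xi_2),\zeta$ (defined in the context). Set $\rho:=\mathbb{E}[\xi_1\xi_2]$ and let $\delta>0$. Let $f_1,\dots,f_k$ be analytic in a neighborhood of $\mathcal{E}_{\rho,\delta}$ and bounded otherwise, and assume $f_j(z)+f_j(\bar z)\in\mathbb{R}$ for all $z\in\mathcal{E}_{\rho,\delta}$ and each $1\le j\le k$. Let $\mathbb{E}[\mathcal{G}(f_i)\mathcal{G}(f_j)]$ denote the covariances defined in the context. Then there exists $0<r<1$ (depending only on $\delta$) such that $$\mathbb{E}[\mathcal{G}(f_i)\mathcal{G}(f_j)]=(\sigma^2-\rho-1)\,a_1(f_i)a_1(f_j)+\left(\mathbb{E}[\xi_1^2\xi_2^2]-2\rho^2-1\right)a_2(f_i)a_2(f_j)+\sum_{l=1}^\infty l(1+\rho^l)\,a_l(f_i)a_l(f_j),$$ where $$a_l(f):=\frac{1}{2\pi i}\oint_{|s|=r}s^{l-1}f(\rho s+1/s)\,ds$$ for $l\ge1$. Furthermore, if $T_j$ is the $j$-th Chebyshev polynomial, and $F_j(z):=2\rho^{j/2}T_j(z/(2\sqrt\rho))$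 for $\rho\ne0$ (and $F_j(z):=z^j$ for the case $\rho=0$), one has $$\mathbb{E}[\mathcal{G}(F_j)\mathcal{G}(F_k)]=\delta_{jk}\left((\sigma^2-\rho-1)\delta_{1j}+\left(\mathbb{E}[\xi_1^2\xi_2^2]-2\rho^2-1\right)\delta_{2j}+j(1+\rho^j)\right),$$ where $\delta_{jk}$ is the Kronecker delta.
   Context: Real elliptic random matrix: $\mathbf{Y}_N=(y_{ij})_{i,j=1}^N$ is an $N\times N$ real elliptic random matrix with atom variables $(\xi_1,\xi_2),\zeta$ if $\{y_{ii}:1\le i\le N\}\cup\{(y_{ij},y_{ji}):1\le i<j\le N\}$ is a collection of independent random elements, the pairs $(y_{ij},y_{ji})$, $i<j$, are iid copies of $(\xi_1,\xi_2)$, and the $y_{ii}$ are iid copies of $\zeta$. Ellipsoids: for $|\rho|<1$, $\mathcal{E}_\rho:=\{z\in\mathbb{C}:\frac{(\operatorname{Re} z)^2}{(1+\rho)^2}+\frac{(\operatorname{Im} z)^2}{(1-\rho)^2}<1\}$; $\mathcal{E}_1:=[-2,2]\subset\mathbb{R}$; $\mathcal{E}_{-1}$ is the segment from $-2i$ to $2i$ on the imaginary axis. For $\delta>0$, $\mathcal{E}_{\rho,\delta}:=\{z\in\mathbb{C}:\operatorname{dist}(z,\mathcal{E}_\rho)\le\delta\}$. The function $m$: $m(z):=\frac{-z+\sqrt{z^2-4\rho}}{2\rho}$ if $\rho\neq0$ and $m(z):=-1/z$ if $\rho=0$, where $\sqrt{z^2-4\rho}$ is the branch of the square root with branch cut $[-2\sqrt\rho,2\sqrt\rho]$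 for $\rho>0$ and $[-2\sqrt{|\rho|},2\sqrt{|\rho|}]\,i$ for $\rho<0$, and which equals $z$ at infinity. Covariances: for $f,g$ analytic in a neighborhood of $\mathcal{E}_{\rho,\delta}$, $$\mathbb{E}[\mathcal{G}(f)\mathcal{G}(g)]:=-\frac{1}{4\pi^2}\oint_{\mathcal{C}}\oint_{\mathcal{C}}f(z)g(w)\,\upsilon(z,w)\,dz\,dw=-\frac{1}{4\pi^2}\oint_{\mathcal{C}}\oint_{\mathcal{C}}f'(z)g'(w)\,m(z)m(w)\beta(z,w)\,dz\,dw,$$ where $\mathcal{C}$ is the contour around the boundary of $\mathcal{E}_{\rho,\delta}$ (same orientation in both integrals), $\upsilon(z,w):=\frac{\partial^2}{\partial z\,\partial w}m(z)m(w)\beta(z,w)$, and $$\beta(z,w):=\sigma^2-\rho-1-\frac{\log(1-\rho m(z)m(w))}{m(z)m(w)}-\frac{\log(1-m(z)m(w))}{m(z)m(w)}+\left(\frac{\mathbb{E}[\xi_1^2\xi_2^2]-2\rho^2-1}{2}\right)m(z)m(w).$$ These are the covariances of the mean-zero multivariate Gaussian vector $(\mathcal{G}(f_1),\dots,\mathcal{G}(f_k))$ that is the limit in distribution, as $N\to\infty$, of $\left(\operatorname{tr}f_j(\frac{1}{\sqrt N}\mathbf{Y}_N)-\mathbb{E}\operatorname{tr}f_j(\frac{1}{\sqrt N}\mathbf{Y}_N)\right)_{j=1}^k$, where $\operatorname{tr} f(\mathbf{M})$ denotes the sum of $f$ over the eigenvalues of $\mathbf{M}$. The Chebyshev polynomials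 $T_j$ are those with generating function $\sum_{l\ge0}T_l(x)t^l=\frac{1-tx}{1-2tx+t^2}$ (first kind). The circle $|s|=r$ is traversed counter-clockwise, and $\rho^{j/2}$ means $(\sqrt\rho)^j$ with the same square root $\sqrt\rho$ as in the argument of $T_j$.
   Formalization: The coefficient E[ξ1²ξ2²]−2ρ²−1 of a_2(f_i)a_2(f_j) and of δ_{2j} is replaced by twice itself, since the covariance as defined gives the factor 2; the printed identities fail, e.g. for F_2, whenever this coefficient is nonzero. *)

theory Defs
  imports
    "HOL-Complex_Analysis.Complex_Analysis"
    "HOL-Probability.Probability"
    "HOL-Computational_Algebra.Formal_Power_Series"
begin

definition atom_variables ::
  "'a measure \<Rightarrow> ('a \<Rightarrow> real) \<Rightarrow> ('a \<Rightarrow> real) \<Rightarrow> ('a \<Rightarrow> real) \<Rightarrow> real \<Rightarrow> bool" where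
  "atom_variables M \<xi>1 \<xi>2 \<zeta> \<sigma> \<longleftrightarrow>
     prob_space M \<and>
     \<xi>1 \<in> borel_measurable M \<and> \<xi>2 \<in> borel_measurable M \<and> \<zeta> \<in> borel_measurable M \<and>
     (\<exists>\<tau>>0. integrable M (\<lambda>\<omega>. \<bar>\<xi>1 \<omega>\<bar> powr (6 + \<tau>)) \<and>
            integrable M (\<lambda>\<omega>. \<bar>\<xi>2 \<omega>\<bar> powr (6 + \<tau>)) \<and>
            integrable M (\<lambda>\<omega>. \<bar>\<zeta> \<omega>\<bar> powr (4 + \<tau>))) \<and>
     prob_space.expectation M \<xi>1 = 0 \<and> prob_space.variance M \<xi>1 = 1 \<and>
     prob_space.expectation M \<xi>2 = 0 \<and> prob_space.variance M \<xi>2 = 1 \<and>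
     prob_space.expectation M \<zeta> = 0 \<and> prob_space.variance M \<zeta> = \<sigma>\<^sup>2"

(* Entries are indexed by {1..N}.  The independent family is indexed by the positions
   on or above the diagonal; on the diagonal the pair (y i i, y i i) generates the same
   sigma-algebra as y i i. *)
definition real_elliptic_random_matrix ::
  "'b measure \<Rightarrow> nat \<Rightarrow> (nat \<Rightarrow> nat \<Rightarrow> 'b \<Rightarrow> real) \<Rightarrow>
   'a measure \<Rightarrow> ('a \<Rightarrow> real) \<Rightarrow> ('a \<Rightarrow> real) \<Rightarrow> ('a \<Rightarrow> real) \<Rightarrow> bool" where
  "real_elliptic_random_matrix P N y M \<xi>1 \<xi>2 \<zeta> \<longleftrightarrow>
     prob_space P \<and>
     prob_space.indep_vars P (\<lambda>_. borel) (\<lambda>(i, j) \<omega>. (y i j \<omega>, y j i \<omega>))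
       {(i, j). 1 \<le> i \<and> i \<le> j \<and> j \<le> N} \<and>
     (\<forall>i j. 1 \<le> i \<and> i < j \<and> j \<le> N \<longrightarrow>
        distr P borel (\<lambda>\<omega>. (y i j \<omega>, y j i \<omega>)) = distr M borel (\<lambda>\<omega>. (\<xi>1 \<omega>, \<xi>2 \<omega>))) \<and>
     (\<forall>i\<in>{1..N}. distr P borel (y i i) = distr M borel \<zeta>)"

definition ellipsoid :: "real \<Rightarrow> complex set" where
  "ellipsoid \<rho> =
     (if \<rho> = 1 then closed_segment (-2) 2
      else if \<rho> = -1 then closed_segment (-2 * \<i>) (2 * \<i>)
      else {z. (Re z)\<^sup>2 / (1 + \<rho>)\<^sup>2 + (Im z)\<^sup>2 / (1 - \<rho>)\<^sup>2 < 1})"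

definition ellipsoid_nbhd :: "real \<Rightarrow> real \<Rightarrow> complex set" where
  "ellipsoid_nbhd \<rho> \<delta> = {z. infdist z (ellipsoid \<rho>) \<le> \<delta>}"

(* The orientation is left open: in the covariance the same path is used for both
   integrations, so reversing it changes nothing. *)
definition boundary_contour :: "real \<Rightarrow> real \<Rightarrow> (real \<Rightarrow> complex) \<Rightarrow> bool" where
  "boundary_contour \<rho> \<delta> C \<longleftrightarrow>
     valid_path C \<and> simple_path C \<and> pathfinish C = pathstart C \<and>
     path_image C = frontier (ellipsoid_nbhd \<rho> \<delta>)"

(* f is analytic in a neighbourhood of the enlarged ellipsoid and bounded off it. *)
definition test_function :: "real \<Rightarrow> real \<Rightarrow> (complex \<Rightarrow> complex) \<Rightarrow> bool" where
  "test_function \<rho> \<delta> f \<longleftrightarrow>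
     (\<exists>U. open U \<and> ellipsoid_nbhd \<rho> \<delta> \<subseteq> U \<and> f holomorphic_on U \<and> bounded (f ` (- U))) \<and>
     (\<forall>z\<in>ellipsoid_nbhd \<rho> \<delta>. f z + f (cnj z) \<in> \<real>)"

(* The branch of sqrt (z^2 - 4 rho) asymptotic to z at infinity: 1 - 4 rho / z^2 is a
   non-positive real exactly when z \<noteq> 0 lies on the segment joining -2 sqrt rho and
   2 sqrt rho (on the imaginary axis if rho < 0), so the cut is that segment. *)
definition sqrt_branch :: "real \<Rightarrow> complex \<Rightarrow> complex" where
  "sqrt_branch \<rho> z = z * csqrt (1 - 4 * of_real \<rho> / z\<^sup>2)"

definition m_fun :: "real \<Rightarrow> complex \<Rightarrow> complex" where
  "m_fun \<rho> z =
     (if \<rho> = 0 then - 1 / z else (- z + sqrt_branch \<rho> z) / (2 * of_real \<rho>))"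

(* Parameters: s2 is the variance of the diagonal atom, \<kappa> is E[xi1^2 xi2^2]. *)
definition beta_fun :: "real \<Rightarrow> real \<Rightarrow> real \<Rightarrow> complex \<Rightarrow> complex \<Rightarrow> complex" where
  "beta_fun \<rho> s2 \<kappa> z w =
     of_real (s2 - \<rho> - 1)
     - Ln (1 - of_real \<rho> * m_fun \<rho> z * m_fun \<rho> w) / (m_fun \<rho> z * m_fun \<rho> w)
     - Ln (1 - m_fun \<rho> z * m_fun \<rho> w) / (m_fun \<rho> z * m_fun \<rho> w)
     + of_real ((\<kappa> - 2 * \<rho>\<^sup>2 - 1) / 2) * m_fun \<rho> z * m_fun \<rho> w"

definition upsilon_fun :: "real \<Rightarrow> real \<Rightarrow> real \<Rightarrow> complex \<Rightarrow> complex \<Rightarrow> complex" where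
  "upsilon_fun \<rho> s2 \<kappa> z w =
     deriv (\<lambda>z'. deriv (\<lambda>w'. m_fun \<rho> z' * m_fun \<rho> w' * beta_fun \<rho> s2 \<kappa> z' w') w) z"

(* The last term of m(z) m(w) beta(z,w) is (\<kappa> - 2 rho^2 - 1)/2 times (m(z) m(w))^2, and
   d^2/dz dw (m(z) m(w))^2 = 4 m(z) m'(z) m(w) m'(w); so it contributes
   2 (\<kappa> - 2 rho^2 - 1) times the product of the second coefficients of f and g. *)
definition G_covariance ::
  "(real \<Rightarrow> complex) \<Rightarrow> real \<Rightarrow> real \<Rightarrow> real \<Rightarrow>
   (complex \<Rightarrow> complex) \<Rightarrow> (complex \<Rightarrow> complex) \<Rightarrow> complex" where
  "G_covariance C \<rho> s2 \<kappa> f g =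
     - 1 / (4 * of_real pi ^ 2) *
       contour_integral C (\<lambda>z. contour_integral C (\<lambda>w. f z * g w * upsilon_fun \<rho> s2 \<kappa> z w))"

definition coeff_a :: "real \<Rightarrow> real \<Rightarrow> nat \<Rightarrow> (complex \<Rightarrow> complex) \<Rightarrow> complex" where
  "coeff_a \<rho> r l f =
     1 / (2 * of_real pi * \<i>) *
       contour_integral (circlepath 0 r) (\<lambda>s. s ^ (l - 1) * f (of_real \<rho> * s + 1 / s))"

definition chebyshev_T :: "nat \<Rightarrow> complex \<Rightarrow> complex" where
  "chebyshev_T j x =
     fps_nth ((1 - fps_const x * fps_X) / (1 - 2 * fps_const x * fps_X + fps_X ^ 2)) j"

definition F_fun :: "real \<Rightarrow> nat \<Rightarrow> complex \<Rightarrow> complex" where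
  "F_fun \<rho> j z =
     (if \<rho> = 0 then z ^ j
      else 2 * csqrt (of_real \<rho>) ^ j * chebyshev_T j (z / (2 * csqrt (of_real \<rho>))))"

end

theory Submission
  imports Defs
begin

text \<open>
  The Joukowski-type map \<open>s \<mapsto> \<rho> s + 1 / s\<close> takes the punctured unit disc bijectively onto the exterior of the
  closed ellipse, and \<open>m\<close> is minus its inverse (\<open>outside_closed_ellipse_joukowski\<close>, \<open>m_fun_joukowski\<close>).
  In particular \<open>\<bar>m\<bar> < 1\<close> outside the ellipse, so that the logarithms in \<open>\<beta>\<close> are given by their Taylor series
  and \<open>\<upsilon>(z, w) = m'(z) m'(w) K(m(z) m(w))\<close>, where \<open>K\<close> is the power series with coefficients \<open>k\<^sub>l\<close> equal to
  \<open>(l + 1) (1 + \<rho>\<^sup>l\<^sup>+\<^sup>1)\<close> apart from corrections at \<open>l = 0\<close> and \<open>l = 1\<close> (\<open>upsilon_fun_eq_kernel\<close>,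
  \<open>covariance_kernel_sums\<close>).

  Let \<open>f\<close> and \<open>g\<close> be holomorphic near the enlarged ellipse. The integrand of the covariance is then holomorphic
  in each variable between the ellipse and the boundary contour. So either integration may be moved
  from the contour to the image of a circle \<open>\<bar>s\<bar> = r\<close>, at the cost of an orientation sign that occurs twice
  (\<open>boundary_contour_integral_eq_circle\<close>). After the substitution \<open>z = \<rho> s + 1 / s\<close>, \<open>w = \<rho> t + 1 / t\<close> the
  covariance is the double integral of \<open>f(z) g(w) K(s t)\<close> over the circle, divided by \<open>(2 \<pi> \<i>)\<^sup>2\<close>, and expanding \<open>K\<close>
  separates the variables:
  it equals \<open>\<Sum>l. k\<^sub>l a\<^sub>l\<^sub>+\<^sub>1(f) a\<^sub>l\<^sub>+\<^sub>1(g)\<close> (\<open>G_covariance_sums\<close>).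

  The radius must satisfy \<open>1 / r - r \<le> \<delta>\<close> only, for then the annulus \<open>r \<le> \<bar>s\<bar> \<le> 1\<close> is mapped into the
  \<open>\<delta>\<close>-neighbourhood of the ellipse (\<open>joukowski_annulus_in_nbhd\<close>), whatever \<open>\<rho>\<close> in \<open>[-1, 1]\<close> is. The
  bound \<open>\<bar>\<rho>\<bar> \<le> 1\<close> holds because \<open>\<rho>\<close> is a correlation of variables with unit variance. The polynomials \<open>F\<^sub>j\<close> satisfy
  \<open>F\<^sub>j(\<rho> s + 1 / s) = \<rho>\<^sup>j s\<^sup>j + s\<^sup>-\<^sup>j\<close> for \<open>j \<ge> 1\<close>, so \<open>a\<^sub>l(F\<^sub>j) = \<delta>\<^sub>l\<^sub>j\<close> and the series reduces to one term.
\<close>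

section \<open>The conformal parametrization of the exterior of the ellipse\<close>

definition joukowski :: "real \<Rightarrow> complex \<Rightarrow> complex" where
  "joukowski \<rho> s = of_real \<rho> * s + 1 / s"

text \<open>
  The closed filled ellipse, or segment when \<open>\<bar>\<rho>\<bar> = 1\<close>, as the image of the closed unit disc under a
  real-linear map. This one formula covers every \<open>\<rho>\<close> in \<open>[-1, 1]\<close>, so that the degenerate cases need no
  separate treatment once \<open>closure_ellipsoid\<close> is known.
\<close>

definition closed_ellipse :: "real \<Rightarrow> complex set" where
  "closed_ellipse \<rho> = (\<lambda>w. w + of_real \<rho> * cnj w) ` cball 0 1"

lemma compact_closed_ellipse: "compact (closed_ellipse \<rho>)"
  unfolding closed_ellipse_def
  by (intro compact_continuous_image continuous_intros compact_cball)

lemma convex_closed_ellipse: "convex (closed_ellipse \<rho>)"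
proof -
  have "linear (\<lambda>w. w + of_real \<rho> * cnj w)"
    by (rule linearI) (auto simp: algebra_simps scaleR_conv_of_real)
  then show ?thesis
    unfolding closed_ellipse_def by (intro convex_linear_image convex_cball)
qed

text \<open>
  On the unit circle \<open>1 / u\<close> is the conjugate of \<open>u\<close>, so the parametrization agrees there with the
  real-linear map that defines the ellipse.
\<close>

lemma joukowski_unit_circle_in_closed_ellipse:
  assumes "cmod u = 1" shows "joukowski \<rho> u \<in> closed_ellipse \<rho>"
proof -
  have "joukowski \<rho> u = cnj u + of_real \<rho> * cnj (cnj u)"
    using assms by (simp add: joukowski_def divide_conv_cnj)
  then show ?thesis
    unfolding closed_ellipse_def using assms by (intro image_eqI[of _ _ "cnj u"]) auto
qed

lemma closure_ellipsoid:
  assumes "\<bar>\<rho>\<bar> \<le> 1"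
  shows "closure (ellipsoid \<rho>) = closed_ellipse \<rho>"
proof -
  consider "\<rho> = 1" | "\<rho> = -1" | "\<bar>\<rho>\<bar> < 1" using assms by fastforce
  then show ?thesis
  proof cases
    case 1
    have "closed_ellipse 1 = closed_segment (-2) 2"
    proof (intro equalityI subsetI)
      fix z assume "z \<in> closed_ellipse 1"
      then obtain w where w: "z = w + cnj w" "cmod w \<le> 1" by (auto simp: closed_ellipse_def)
      have "\<bar>Re w\<bar> \<le> 1" using w(2) abs_Re_le_cmod[of w] by linarith
      then show "z \<in> closed_segment (-2) 2" unfolding in_segment w(1)
        by (intro exI[of _ "(1 + Re w) / 2"]) (auto simp: complex_eq_iff field_simps)
    next
      fix z :: complex assume "z \<in> closed_segment (-2) 2"
      then obtain u where u: "0 \<le> u" "u \<le> 1" "z = (1-u) *\<^sub>R (-2) + u *\<^sub>R 2"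
        unfolding in_segment by blast
      show "z \<in> closed_ellipse 1" unfolding closed_ellipse_def
        by (rule image_eqI[of _ _ "of_real (2*u-1)"])
           (use u in \<open>auto simp: complex_eq_iff algebra_simps simp flip: of_real_diff of_real_mult\<close>)
    qed
    then show ?thesis using 1 by (simp add: ellipsoid_def)
  next
    case 2
    have "closed_ellipse (-1) = closed_segment (-2*\<i>) (2*\<i>)"
    proof (intro equalityI subsetI)
      fix z assume "z \<in> closed_ellipse (-1)"
      then obtain w where w: "z = w - cnj w" "cmod w \<le> 1" by (auto simp: closed_ellipse_def)
      have "\<bar>Im w\<bar> \<le> 1" using w(2) abs_Im_le_cmod[of w] by linarith
      then show "z \<in> closed_segment (-2*\<i>) (2*\<i>)" unfolding in_segment w(1)
        by (intro exI[of _ "(1 + Im w) / 2"]) (auto simp: complex_eq_iff field_simps)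
    next
      fix z :: complex assume "z \<in> closed_segment (-2*\<i>) (2*\<i>)"
      then obtain u where u: "0 \<le> u" "u \<le> 1" "z = (1-u) *\<^sub>R (-2*\<i>) + u *\<^sub>R (2*\<i>)"
        unfolding in_segment by blast
      show "z \<in> closed_ellipse (-1)" unfolding closed_ellipse_def
        by (rule image_eqI[of _ _ "\<i> * of_real (2*u-1)"])
           (use u in \<open>auto simp: complex_eq_iff norm_mult algebra_simps simp flip: of_real_diff of_real_mult\<close>)
    qed
    then show ?thesis using 2 by (simp add: ellipsoid_def)
  next
    case 3
    have pos: "1 + \<rho> > 0" "1 - \<rho> > 0" using 3 by auto
    have E: "ellipsoid \<rho> = {z. (Re z)\<^sup>2 / (1 + \<rho>)\<^sup>2 + (Im z)\<^sup>2 / (1 - \<rho>)\<^sup>2 < 1}"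
      using 3 by (auto simp: ellipsoid_def)
    have img: "ellipsoid \<rho> = (\<lambda>w. w + of_real \<rho> * cnj w) ` ball 0 1"
    proof (intro equalityI subsetI)
      fix z assume z: "z \<in> ellipsoid \<rho>"
      define w where "w = Complex (Re z / (1 + \<rho>)) (Im z / (1 - \<rho>))"
      have "cmod w < 1" using z by (simp add: E w_def cmod_def power_divide)
      moreover have "z = w + of_real \<rho> * cnj w" 
        using pos by (simp add: w_def complex_eq_iff divide_simps) (simp add: algebra_simps)
      ultimately show "z \<in> (\<lambda>w. w + of_real \<rho> * cnj w) ` ball 0 1" by auto
    next
      fix z assume "z \<in> (\<lambda>w. w + of_real \<rho> * cnj w) ` ball 0 1"
      then obtain w where w: "cmod w < 1" "z = w + of_real \<rho> * cnj w" by auto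
      have "Re z = (1+\<rho>) * Re w" "Im z = (1-\<rho>) * Im w" by (auto simp: w algebra_simps)
      then have "Re z / (1+\<rho>) = Re w" "Im z / (1-\<rho>) = Im w" using pos by auto
      then have "(Re z)\<^sup>2 / (1 + \<rho>)\<^sup>2 + (Im z)\<^sup>2 / (1 - \<rho>)\<^sup>2 = (cmod w)\<^sup>2"
        by (simp add: cmod_power2 flip: power_divide)
      also have "\<dots> < 1" using w(1) by (simp add: power_less_one_iff abs_square_less_1)
      finally show "z \<in> ellipsoid \<rho>" by (simp add: E)
    qed
    show ?thesis
    proof (rule antisym)
      have "ellipsoid \<rho> \<subseteq> closed_ellipse \<rho>" unfolding img closed_ellipse_def
        by (intro image_mono) auto
      then show "closure (ellipsoid \<rho>) \<subseteq> closed_ellipse \<rho>"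
        using compact_closed_ellipse compact_imp_closed closure_minimal by blast
      have "closed_ellipse \<rho> = (\<lambda>w. w + of_real \<rho> * cnj w) ` closure (ball 0 1)"
        by (simp add: closed_ellipse_def)
      also have "\<dots> \<subseteq> closure (ellipsoid \<rho>)" unfolding img
        by (rule continuous_image_closure_subset[of UNIV]) (auto intro!: continuous_intros)
      finally show "closed_ellipse \<rho> \<subseteq> closure (ellipsoid \<rho>)" .
    qed
  qed
qed

text \<open>
  If \<open>\<rho> s + 1 / s = w + \<rho> cnj w\<close>, then \<open>\<bar>1 - w s\<bar> \<le> \<bar>s\<bar> \<bar>cnj w - s\<bar>\<close>, whereas
  \<open>\<bar>1 - w s\<bar>\<^sup>2 - \<bar>cnj w - s\<bar>\<^sup>2 = (1 - \<bar>s\<bar>\<^sup>2) (1 - \<bar>w\<bar>\<^sup>2)\<close> is nonnegative for \<open>w\<close> in the closed disc.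
  The two are compatible only when \<open>s = cnj w\<close> and \<open>w s = 1\<close>, which forces \<open>\<bar>s\<bar> = 1\<close>.
\<close>

lemma joukowski_notin_closed_ellipse:
  assumes \<rho>: "\<bar>\<rho>\<bar> \<le> 1" and s: "s \<noteq> 0" "cmod s < 1"
  shows "joukowski \<rho> s \<notin> closed_ellipse \<rho>"
proof
  assume "joukowski \<rho> s \<in> closed_ellipse \<rho>"
  then obtain w where w: "cmod w \<le> 1" "of_real \<rho> * s + 1 / s = w + of_real \<rho> * cnj w"
    by (auto simp: closed_ellipse_def joukowski_def)
  have "1 - w * s = s * of_real \<rho> * (cnj w - s)"
    using w(2) s(1) by (simp add: field_simps)
  then have "cmod (1 - w * s) = cmod s * \<bar>\<rho>\<bar> * cmod (cnj w - s)"
    by (simp add: norm_mult)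
  also have "\<dots> \<le> cmod s * cmod (cnj w - s)"
    using \<rho> mult_right_mono[of "\<bar>\<rho>\<bar>" 1 "cmod (cnj w - s)"] mult_left_mono[of "\<bar>\<rho>\<bar>*cmod (cnj w - s)" "cmod (cnj w - s)" "cmod s"] 
    by (simp add: mult.assoc)
  finally have le: "cmod (1 - w * s) \<le> cmod s * cmod (cnj w - s)" .
  have "(cmod (1 - w * s))\<^sup>2 - (cmod (cnj w - s))\<^sup>2 = (1 - (cmod s)\<^sup>2) * (1 - (cmod w)\<^sup>2)"
    unfolding cmod_power2 by (simp add: power2_eq_square) (simp add: algebra_simps)
  moreover have "(1 - (cmod s)\<^sup>2) * (1 - (cmod w)\<^sup>2) \<ge> 0"
    using s w(1) by (intro mult_nonneg_nonneg) (auto simp: power_le_one)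
  ultimately have "(cmod (cnj w - s))\<^sup>2 \<le> (cmod (1 - w * s))\<^sup>2" by linarith
  then have ge: "cmod (cnj w - s) \<le> cmod (1 - w * s)" by (rule power2_le_imp_le) simp
  have "cmod (cnj w - s) \<le> cmod s * cmod (cnj w - s)" using le ge by linarith
  then have "(1 - cmod s) * cmod (cnj w - s) \<le> 0" by (simp add: algebra_simps)
  then have "cmod (cnj w - s) = 0" using s(2) by (simp add: mult_le_0_iff)
  then have "s = cnj w" "1 = w * s" using le by auto
  then have "cmod w * cmod s = 1" "cmod s = cmod w" by (metis norm_mult norm_one) (use \<open>s = cnj w\<close> in simp)
  then show False using s(2) w(1) by (metis abs_norm_cancel abs_square_less_1 order_less_irrefl power2_eq_square)
qed

text \<open>
  The circles with radius between \<open>1\<close> and \<open>1 / \<bar>\<rho>\<bar>\<close> are mapped to ellipses with semi-axes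
  \<open>\<bar>1 / \<tau> + \<rho> \<tau>\<bar> \<le> 1 + \<rho>\<close> and \<open>\<bar>1 / \<tau> - \<rho> \<tau>\<bar> \<le> 1 - \<rho>\<close>, hence into the closed ellipse. This is what
  excludes the case that neither preimage of an exterior point lies in the unit disc.
\<close>

lemma joukowski_large_in_closed_ellipse:
  assumes s: "1 \<le> cmod s" and \<rho>s: "\<bar>\<rho>\<bar> * cmod s \<le> 1"
  shows "joukowski \<rho> s \<in> closed_ellipse \<rho>"
proof (cases "\<bar>\<rho>\<bar> < 1")
  case False
  then have "cmod s = 1"
    using s \<rho>s mult_right_mono[of 1 "\<bar>\<rho>\<bar>" "cmod s"] by (simp; linarith)
  then show ?thesis by (rule joukowski_unit_circle_in_closed_ellipse)
next
  case True
  then have pos: "1 + \<rho> > 0" "1 - \<rho> > 0" by auto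
  define N where "N = (cmod s)\<^sup>2"
  have N: "N \<ge> 1" using s by (simp add: N_def)
  have \<rho>N: "\<rho>\<^sup>2 * N \<le> 1"
  proof -
    have "(\<bar>\<rho>\<bar> * cmod s)\<^sup>2 \<le> 1" using \<rho>s by (simp add: power_le_one)
    then show ?thesis by (simp add: N_def power_mult_distrib)
  qed
  have Nxy: "N = (Re s)\<^sup>2 + (Im s)\<^sup>2" by (simp add: N_def cmod_power2)
  define c d where "c = (\<rho> + 1 / N) * Re s / (1 + \<rho>)" and "d = (\<rho> - 1 / N) * Im s / (1 - \<rho>)"
  \<comment> \<open>With \<open>N = \<bar>s\<bar>\<^sup>2\<close>, both bounds on the semi-axes reduce to \<open>(N - 1) (\<rho>\<^sup>2 N - 1) \<le> 0\<close>.\<close>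
  have key: "(N - 1) * (\<rho>\<^sup>2 * N - 1) \<le> 0" using N \<rho>N by (intro mult_nonneg_nonpos) auto
  have bnd: "\<rho>\<^sup>2 * N + 1 / N \<le> 1 + \<rho>\<^sup>2"
    using key N by (simp add: field_simps power2_eq_square)
  have "(\<rho> + 1/N)\<^sup>2 * N = \<rho>\<^sup>2 * N + 1 / N + 2 * \<rho>"
    using N by (simp add: field_simps power2_eq_square)
  then have cN: "(\<rho> + 1/N)\<^sup>2 * N \<le> (1 + \<rho>)\<^sup>2" using bnd by (simp add: power2_sum)
  have "(\<rho> - 1/N)\<^sup>2 * N = \<rho>\<^sup>2 * N + 1 / N - 2 * \<rho>"
    using N by (simp add: field_simps power2_eq_square)
  then have dN: "(\<rho> - 1/N)\<^sup>2 * N \<le> (1 - \<rho>)\<^sup>2" using bnd by (simp add: power2_diff)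
  have c: "c\<^sup>2 \<le> (Re s)\<^sup>2 / N"
  proof -
    have "c\<^sup>2 = ((\<rho> + 1/N)\<^sup>2 * N / (1+\<rho>)\<^sup>2) * ((Re s)\<^sup>2 / N)"
      using N by (simp add: c_def power_divide power_mult_distrib)
    also have "\<dots> \<le> 1 * ((Re s)\<^sup>2 / N)"
      using cN pos N by (intro mult_right_mono) (auto simp: divide_le_eq_1)
    finally show ?thesis by simp
  qed
  have d: "d\<^sup>2 \<le> (Im s)\<^sup>2 / N"
  proof -
    have "d\<^sup>2 = ((\<rho> - 1/N)\<^sup>2 * N / (1-\<rho>)\<^sup>2) * ((Im s)\<^sup>2 / N)"
      using N by (simp add: d_def power_divide power_mult_distrib)
    also have "\<dots> \<le> 1 * ((Im s)\<^sup>2 / N)"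
      using dN pos N by (intro mult_right_mono) (auto simp: divide_le_eq_1)
    finally show ?thesis by simp
  qed
  have "c\<^sup>2 + d\<^sup>2 \<le> ((Re s)\<^sup>2 + (Im s)\<^sup>2) / N" using c d by (simp add: add_divide_distrib)
  also have "\<dots> = 1" using N by (simp flip: Nxy)
  finally have "cmod (Complex c d) \<le> 1" by (simp add: cmod_def)
  moreover have "joukowski \<rho> s = Complex c d + of_real \<rho> * cnj (Complex c d)"
  proof (rule complex_eqI)
    have "Re (joukowski \<rho> s) = (\<rho> + 1/N) * Re s"
      by (simp add: joukowski_def Re_divide Nxy algebra_simps)
    then have "Re (joukowski \<rho> s) = (1 + \<rho>) * c" using pos by (simp add: c_def)
    then show "Re (joukowski \<rho> s) = Re (Complex c d + of_real \<rho> * cnj (Complex c d))"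
      by (simp add: algebra_simps)
    have "Im (joukowski \<rho> s) = (\<rho> - 1/N) * Im s"
      by (simp add: joukowski_def Im_divide Nxy algebra_simps)
    then have "Im (joukowski \<rho> s) = (1 - \<rho>) * d" using pos by (simp add: d_def)
    then show "Im (joukowski \<rho> s) = Im (Complex c d + of_real \<rho> * cnj (Complex c d))"
      by (simp add: algebra_simps)
  qed
  ultimately show ?thesis by (auto simp: closed_ellipse_def)
qed

text \<open>
  The preimages of \<open>z\<close> are the roots of \<open>\<rho> s\<^sup>2 - z s + 1\<close>, whose product is \<open>1 / \<rho>\<close> for \<open>\<rho> \<noteq> 0\<close>. If a root \<open>s\<close> has
  modulus at least \<open>1\<close>, then \<open>\<bar>\<rho> s\<bar> > 1\<close>, because otherwise \<open>z\<close> would lie in the ellipse; so the other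
  root \<open>1 / (\<rho> s)\<close> is in the open disc.
\<close>

lemma outside_closed_ellipse_joukowski:
  assumes \<rho>: "\<bar>\<rho>\<bar> \<le> 1" and z: "z \<notin> closed_ellipse \<rho>"
  obtains s where "s \<noteq> 0" "cmod s < 1" "z = joukowski \<rho> s"
proof -
  have z0: "z \<noteq> 0" using z by (force simp: closed_ellipse_def image_iff dest: bspec[of _ _ 0])
  obtain s where s: "of_real \<rho> * s\<^sup>2 - z * s + 1 = 0"
  proof (cases "\<rho> = 0")
    case True
    then show ?thesis using that[of "1/z"] z0 by simp
  next
    case False
    then have "of_real \<rho> * ((z + csqrt (z\<^sup>2 - 4 * of_real \<rho>)) / (2 * of_real \<rho>))\<^sup>2
       - z * ((z + csqrt (z\<^sup>2 - 4 * of_real \<rho>)) / (2 * of_real \<rho>)) + 1 = 0"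
      by (simp add: power_divide power2_sum divide_simps) (simp add: algebra_simps power2_eq_square)
    then show ?thesis using that by blast
  qed
  then have s0: "s \<noteq> 0" by auto
  have zs: "z = joukowski \<rho> s" using s s0 by (simp add: joukowski_def field_simps power2_eq_square)
  show ?thesis
  proof (cases "cmod s < 1")
    case True then show ?thesis using that s0 zs by blast
  next
    case False
    then have gt: "\<bar>\<rho>\<bar> * cmod s > 1"
      using joukowski_large_in_closed_ellipse[of s \<rho>] z zs by force
    then have \<rho>0: "\<rho> \<noteq> 0" by auto
    define t where "t = 1 / (of_real \<rho> * s)"
    have "t \<noteq> 0" "joukowski \<rho> t = z" using s0 \<rho>0 by (auto simp: t_def zs joukowski_def)
    moreover have "cmod t < 1" using gt by (simp add: t_def norm_divide norm_mult)
    ultimately show ?thesis using that by blast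
  qed
qed

text \<open>
  The Cayley transform sends the unit disc to the right half-plane, where the principal square root
  inverts squaring; this selects the branch in \<open>m_fun_joukowski\<close>.
\<close>

lemma Re_cayley_pos:
  assumes "cmod a < 1" shows "0 < Re ((1 - a) / (1 + a))"
proof -
  have "1 + a \<noteq> 0" using assms by (metis add_eq_0_iff norm_minus_cancel norm_one order_less_irrefl)
  then have "(cmod (1 + a))\<^sup>2 > 0" by simp
  moreover have "(Re a)\<^sup>2 + (Im a)\<^sup>2 < 1"
    using assms by (metis abs_norm_cancel abs_square_less_1 cmod_power2)
  ultimately show ?thesis
    by (simp add: Re_divide cmod_power2) (simp add: algebra_simps power2_eq_square)
qed

lemma cmod_of_real_mult_less_1:
  assumes "\<bar>\<rho>\<bar> \<le> 1" "cmod p < 1" shows "cmod (of_real \<rho> * p) < 1"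
  using assms mult_right_mono[of "\<bar>\<rho>\<bar>" 1 "cmod p"] by (simp add: norm_mult)

lemma branch_argument_joukowski:
  assumes \<rho>: "\<bar>\<rho>\<bar> \<le> 1" and s: "s \<noteq> 0" "cmod s < 1"
  defines "a \<equiv> of_real \<rho> * s\<^sup>2"
  shows "joukowski \<rho> s \<noteq> 0" "cmod a < 1"
    "1 - 4 * of_real \<rho> / (joukowski \<rho> s)\<^sup>2 = ((1 - a) / (1 + a))\<^sup>2"
proof -
  have "cmod (s\<^sup>2) < 1" using s by (simp add: norm_power power_less_one_iff)
  then show a: "cmod a < 1" unfolding a_def using \<rho> by (intro cmod_of_real_mult_less_1)
  have a1: "1 + a \<noteq> 0" using a by (metis add_eq_0_iff norm_minus_cancel norm_one order_less_irrefl)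
  have j: "joukowski \<rho> s = (1 + a) / s" using s by (simp add: joukowski_def a_def field_simps power2_eq_square)
  show "joukowski \<rho> s \<noteq> 0" using j a1 s by simp
  have "4 * of_real \<rho> / (joukowski \<rho> s)\<^sup>2 = 4 * a / (1+a)\<^sup>2"
    unfolding j using s by (simp add: a_def power_divide)
  then have "1 - 4 * of_real \<rho> / (joukowski \<rho> s)\<^sup>2 = 1 - 4 * a / (1 + a)\<^sup>2" by simp
  also have "\<dots> = ((1 - a) / (1 + a))\<^sup>2"
    using a1 by (simp add: power_divide divide_simps) (simp add: algebra_simps power2_eq_square)
  finally show "1 - 4 * of_real \<rho> / (joukowski \<rho> s)\<^sup>2 = ((1 - a) / (1 + a))\<^sup>2" .
qed

text \<open>
  With \<open>a = \<rho> s\<^sup>2\<close> the argument of the square root is the square of \<open>(1 - a) / (1 + a)\<close>, whose real part is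
  positive. Hence \<open>m\<close> is, up to sign, the inverse of the parametrization.
\<close>

lemma m_fun_joukowski:
  assumes \<rho>: "\<bar>\<rho>\<bar> \<le> 1" and s: "s \<noteq> 0" "cmod s < 1"
  shows "m_fun \<rho> (joukowski \<rho> s) = - s"
proof (cases "\<rho> = 0")
  case True then show ?thesis by (simp add: m_fun_def joukowski_def)
next
  case False
  define a where "a = of_real \<rho> * s\<^sup>2"
  note B = branch_argument_joukowski[OF assms, folded a_def]
  have a1: "1 + a \<noteq> 0" using B(2) by (metis add_eq_0_iff norm_minus_cancel norm_one order_less_irrefl)
  have j: "joukowski \<rho> s = (1 + a) / s" using s by (simp add: joukowski_def a_def field_simps power2_eq_square)
  have "csqrt (1 - 4 * of_real \<rho> / (joukowski \<rho> s)\<^sup>2) = (1 - a) / (1 + a)"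
    unfolding B(3) using Re_cayley_pos[OF B(2)] by (intro csqrt_square) auto
  then have "sqrt_branch \<rho> (joukowski \<rho> s) = (1 - a) / s"
    unfolding sqrt_branch_def using a1 by (simp add: j)
  then have "m_fun \<rho> (joukowski \<rho> s) = (- (1 + a) / s + (1 - a) / s) / (2 * of_real \<rho>)"
    using False by (simp add: m_fun_def j minus_divide_left)
  also have "\<dots> = - s" using False s by (simp add: a_def field_simps power2_eq_square)
  finally show ?thesis .
qed

lemma m_fun_outside:
  assumes \<rho>: "\<bar>\<rho>\<bar> \<le> 1" and z: "z \<notin> closed_ellipse \<rho>"
  shows "m_fun \<rho> z \<noteq> 0" "cmod (m_fun \<rho> z) < 1"
  using outside_closed_ellipse_joukowski[OF assms] m_fun_joukowski[OF \<rho>]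
  by (metis neg_equal_0_iff_equal, metis norm_minus_cancel)

lemma holomorphic_on_m_fun:
  assumes \<rho>: "\<bar>\<rho>\<bar> \<le> 1"
  shows "m_fun \<rho> holomorphic_on - closed_ellipse \<rho>"
proof -
  have nz: "z \<noteq> 0 \<and> 1 - 4 * of_real \<rho> / z\<^sup>2 \<notin> \<real>\<^sub>\<le>\<^sub>0" if z: "z \<in> - closed_ellipse \<rho>" for z
  proof -
    obtain s where s: "s \<noteq> 0" "cmod s < 1" "z = joukowski \<rho> s"
      using outside_closed_ellipse_joukowski[OF \<rho>] z by blast
    define b where "b = (1 - of_real \<rho> * s\<^sup>2) / (1 + of_real \<rho> * s\<^sup>2)"
    note B = branch_argument_joukowski[OF \<rho> s(1,2), folded s(3) b_def]
    have b: "0 < Re b" unfolding b_def using Re_cayley_pos[OF B(2)] .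
    have "b\<^sup>2 \<notin> \<real>\<^sub>\<le>\<^sub>0"
    proof
      assume "b\<^sup>2 \<in> \<real>\<^sub>\<le>\<^sub>0"
      then have "Re b * Im b = 0" "(Re b)\<^sup>2 \<le> (Im b)\<^sup>2"
        by (auto simp: complex_nonpos_Reals_iff power2_eq_square)
      then show False using b by auto
    qed
    then show ?thesis using B by simp
  qed
  show ?thesis
  proof (cases "\<rho> = 0")
    case True
    then have "m_fun \<rho> = (\<lambda>z. - 1 / z)" by (auto simp: m_fun_def)
    then show ?thesis using nz by (auto intro!: holomorphic_intros)
  next
    case False
    then have "m_fun \<rho> = (\<lambda>z. (- z + z * csqrt (1 - 4 * of_real \<rho> / z\<^sup>2)) / (2 * of_real \<rho>))"
      by (auto simp: m_fun_def sqrt_branch_def)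
    then show ?thesis using nz False by (auto intro!: holomorphic_intros)
  qed
qed

lemma holomorphic_on_joukowski: "0 \<notin> A \<Longrightarrow> joukowski \<rho> holomorphic_on A"
  unfolding joukowski_def[abs_def] by (auto intro!: holomorphic_intros)

text \<open>
  The chain rule applied to \<open>m (joukowski \<rho> s) = - s\<close>: under the substitution \<open>z = joukowski \<rho> s\<close> the
  differential \<open>m'(z) dz\<close> becomes \<open>- ds\<close>.
\<close>

lemma deriv_m_fun_joukowski:
  assumes \<rho>: "\<bar>\<rho>\<bar> \<le> 1" and s: "s \<noteq> 0" "cmod s < 1"
  shows "deriv (m_fun \<rho>) (joukowski \<rho> s) * deriv (joukowski \<rho>) s = - 1"
proof -
  define A where "A = ball 0 1 - {0::complex}"
  have A: "open A" "s \<in> A" using s by (auto simp: A_def)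
  have o: "open (- closed_ellipse \<rho>)" using compact_closed_ellipse compact_imp_closed by blast
  have "joukowski \<rho> s \<in> - closed_ellipse \<rho>" using joukowski_notin_closed_ellipse assms by blast
  then have "(m_fun \<rho> has_field_derivative deriv (m_fun \<rho>) (joukowski \<rho> s)) (at (joukowski \<rho> s))"
    using holomorphic_derivI[OF holomorphic_on_m_fun[OF \<rho>] o] by simp
  moreover have "(joukowski \<rho> has_field_derivative deriv (joukowski \<rho>) s) (at s)"
    by (rule holomorphic_derivI[OF holomorphic_on_joukowski[of A] A]) (simp add: A_def)
  ultimately have "(m_fun \<rho> \<circ> joukowski \<rho> has_field_derivative
      deriv (m_fun \<rho>) (joukowski \<rho> s) * deriv (joukowski \<rho>) s) (at s)"
    by (rule DERIV_chain)
  moreover have "(m_fun \<rho> \<circ> joukowski \<rho> has_field_derivative - 1) (at s)"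
  proof (rule has_field_derivative_transform_within_open)
    show "(uminus has_field_derivative - 1) (at s)" by (auto intro!: derivative_eq_intros)
    show "- y = (m_fun \<rho> \<circ> joukowski \<rho>) y" if "y \<in> A" for y 
      using m_fun_joukowski[OF \<rho>] that by (simp add: A_def)
  qed (use A in auto)
  ultimately show ?thesis by (rule DERIV_unique)
qed

section \<open>Deforming the boundary contour to a circle\<close>

text \<open>
  The homology form of Cauchy's theorem for a difference of two loops. A path from one to the other
  inside \<open>S\<close>, run forth and back, joins them to a single loop with winding number zero about every
  point outside \<open>S\<close>; the connected set \<open>T\<close> provides this path.
\<close>

lemma homologous_loops_contour_integral_eq:
  assumes S: "open S" and h: "h holomorphic_on S"
    and C: "valid_path C" "pathfinish C = pathstart C" "path_image C \<subseteq> S"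
    and D: "valid_path D" "pathfinish D = pathstart D" "path_image D \<subseteq> S"
    and T: "connected T" "T \<subseteq> S" "pathstart C \<in> T" "pathstart D \<in> T"
    and wind: "\<And>w. w \<notin> S \<Longrightarrow> winding_number C w = winding_number D w"
  shows "contour_integral C h = contour_integral D h"
proof -
  define V where "V = connected_component_set S (pathstart C)"
  have V: "open V" "connected V" "V \<subseteq> S"
    using S by (auto simp: V_def open_connected_component connected_component_subset)
  have "T \<subseteq> V" unfolding V_def using T by (intro connected_component_maximal) auto
  then have "pathstart C \<in> V" "pathstart D \<in> V" using T by auto
  then obtain g where g: "polynomial_function g" "path_image g \<subseteq> V"
      "pathstart g = pathstart C" "pathfinish g = pathstart D"
    using connected_open_polynomial_connected[OF V(1,2)] by metis
  have vg: "valid_path g" using g(1) by (rule valid_path_polynomial_function)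
  define L where "L = C +++ g +++ reversepath D +++ reversepath g"
  have gS: "path_image g \<subseteq> S" using g(2) V(3) by blast
  have vD: "valid_path (reversepath D)" "valid_path (reversepath g)"
    using D vg by auto
  have ends: "pathstart (reversepath D) = pathstart D" "pathfinish (reversepath D) = pathstart D"
    using D by simp_all
  have v3: "valid_path (reversepath D +++ reversepath g)"
    using vD g(4) ends by (intro valid_path_join) auto
  have v2: "valid_path (g +++ reversepath D +++ reversepath g)"
    using vg v3 g(4) ends by (intro valid_path_join) auto
  have vL: "valid_path L" unfolding L_def by (rule valid_path_join[OF C(1) v2]) (simp add: C g)
  have loop: "pathfinish L = pathstart L" by (simp add: L_def g)
  have imL: "path_image L \<subseteq> S"
    unfolding L_def using C D gS by (intro subset_path_image_join) auto
  have w0: "winding_number L w = 0" if w: "w \<notin> S" for w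
  proof -
    have nin: "w \<notin> path_image C" "w \<notin> path_image D" "w \<notin> path_image g" using w C D gS by auto
    have p: "path C" "path D" "path g" using C D vg by (auto intro: valid_path_imp_path)
    have "winding_number L w = winding_number C w + (winding_number g w + 
        (winding_number (reversepath D) w + winding_number (reversepath g) w))"
      unfolding L_def using nin p g C(2) ends by (simp add: winding_number_join not_in_path_image_join)
    then show ?thesis using nin p wind[OF w] by (simp add: winding_number_reversepath)
  qed
  have "(h has_contour_integral 0) L"
    by (rule Cauchy_theorem_global[OF S h vL loop imL w0])
  moreover have "(h has_contour_integral (contour_integral C h + (contour_integral g h +
      (- contour_integral D h + - contour_integral g h)))) L"
    unfolding L_def
    using C D vg vD v2 v3 S h gS
    by (intro has_contour_integral_join has_contour_integral_reversepath has_contour_integral_integral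
          contour_integrable_holomorphic_simple[of h S]) auto
  ultimately show ?thesis
    by (auto dest!: contour_integral_unique)
qed

lemma ellipsoid_nbhd_eq:
  assumes "\<bar>\<rho>\<bar> \<le> 1"
  shows "ellipsoid_nbhd \<rho> \<delta> = {z. infdist z (closed_ellipse \<rho>) \<le> \<delta>}"
  unfolding ellipsoid_nbhd_def infdist_eq_setdist
  by (simp add: setdist_closure_2 flip: closure_ellipsoid[OF assms])

lemma zero_in_closed_ellipse: "0 \<in> closed_ellipse \<rho>"
  unfolding closed_ellipse_def by (rule image_eqI[of _ _ 0]) auto

lemma closed_ellipse_nearest_point:
  obtains p where "p \<in> closed_ellipse \<rho>" "infdist z (closed_ellipse \<rho>) = dist z p"
  using infdist_attains_inf[of "closed_ellipse \<rho>" z] compact_closed_ellipse compact_imp_closed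
    zero_in_closed_ellipse by blast

lemma ellipsoid_nbhd_sums:
  assumes \<rho>: "\<bar>\<rho>\<bar> \<le> 1"
  shows "ellipsoid_nbhd \<rho> \<delta> = {x + y | x y. x \<in> closed_ellipse \<rho> \<and> y \<in> cball 0 \<delta>}"
proof (intro equalityI subsetI)
  fix z assume z: "z \<in> ellipsoid_nbhd \<rho> \<delta>"
  obtain p where p: "p \<in> closed_ellipse \<rho>" "infdist z (closed_ellipse \<rho>) = dist z p"
    by (rule closed_ellipse_nearest_point)
  then have "z - p \<in> cball 0 \<delta>" "z = p + (z - p)"
    using z by (auto simp: ellipsoid_nbhd_eq[OF \<rho>] dist_norm norm_minus_commute)
  then show "z \<in> {x + y | x y. x \<in> closed_ellipse \<rho> \<and> y \<in> cball 0 \<delta>}" using p by blast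
next
  fix z assume "z \<in> {x + y | x y. x \<in> closed_ellipse \<rho> \<and> y \<in> cball 0 \<delta>}"
  then obtain x y where "x \<in> closed_ellipse \<rho>" "norm y \<le> \<delta>" "z = x + y" by auto
  then show "z \<in> ellipsoid_nbhd \<rho> \<delta>"
    by (auto simp: ellipsoid_nbhd_eq[OF \<rho>] dist_norm intro!: infdist_le2[of x])
qed

lemma compact_convex_ellipsoid_nbhd:
  assumes "\<bar>\<rho>\<bar> \<le> 1"
  shows "compact (ellipsoid_nbhd \<rho> \<delta>)" "convex (ellipsoid_nbhd \<rho> \<delta>)"
proof -
  show "compact (ellipsoid_nbhd \<rho> \<delta>)" unfolding ellipsoid_nbhd_sums[OF assms]
    by (intro compact_sums compact_closed_ellipse compact_cball)
  have "ellipsoid_nbhd \<rho> \<delta> = (\<Union>x\<in>closed_ellipse \<rho>. \<Union>y\<in>cball 0 \<delta>. {x + y})"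
    unfolding ellipsoid_nbhd_sums[OF assms] by blast
  then show "convex (ellipsoid_nbhd \<rho> \<delta>)"
    using convex_sums[OF convex_closed_ellipse convex_cball] by simp
qed

lemma open_infdist_less: "open {z :: complex. infdist z A < \<delta>}"
  by (intro open_Collect_less continuous_intros)

lemma ellipsoid_nbhd_interior:
  assumes "\<bar>\<rho>\<bar> \<le> 1"
  shows "{z. infdist z (closed_ellipse \<rho>) < \<delta>} \<subseteq> interior (ellipsoid_nbhd \<rho> \<delta>)"
  by (rule interior_maximal) (auto simp: ellipsoid_nbhd_eq[OF assms] open_infdist_less)

lemma closed_ellipse_subset_interior:
  assumes "\<bar>\<rho>\<bar> \<le> 1" "\<delta> > 0"
  shows "closed_ellipse \<rho> \<subseteq> interior (ellipsoid_nbhd \<rho> \<delta>)"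
  using ellipsoid_nbhd_interior[OF assms(1)] assms(2) by fastforce

lemma frontier_ellipsoid_nbhd:
  assumes "\<bar>\<rho>\<bar> \<le> 1" "z \<in> frontier (ellipsoid_nbhd \<rho> \<delta>)"
  shows "z \<in> ellipsoid_nbhd \<rho> \<delta>" "infdist z (closed_ellipse \<rho>) = \<delta>"
proof -
  have "closed (ellipsoid_nbhd \<rho> \<delta>)"
    using compact_convex_ellipsoid_nbhd[OF assms(1)] compact_imp_closed by blast
  then show z: "z \<in> ellipsoid_nbhd \<rho> \<delta>"
    using assms(2) by (simp add: frontier_def)
  have "z \<notin> interior (ellipsoid_nbhd \<rho> \<delta>)" using assms(2) by (simp add: frontier_def)
  then show "infdist z (closed_ellipse \<rho>) = \<delta>"
    using z ellipsoid_nbhd_interior[OF assms(1), of \<delta>] by (force simp: ellipsoid_nbhd_eq[OF assms(1)])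
qed

text \<open>
  Moving \<open>s\<close> radially to the unit circle changes \<open>\<rho> s + 1 / s\<close> by at most
  \<open>(1 - \<bar>s\<bar>) + (1 / \<bar>s\<bar> - 1) = 1 / \<bar>s\<bar> - \<bar>s\<bar>\<close>, a bound that is uniform in \<open>\<rho>\<close>. This is why the radius \<open>r\<close> can be
  chosen from \<open>\<delta>\<close> alone.
\<close>

lemma joukowski_annulus_in_nbhd:
  assumes \<rho>: "\<bar>\<rho>\<bar> \<le> 1" and r: "0 < r" "1 / r - r \<le> \<delta>" and s: "r \<le> cmod s" "cmod s \<le> 1"
  shows "joukowski \<rho> s \<in> ellipsoid_nbhd \<rho> \<delta>"
proof -
  define u where "u = s / of_real (cmod s)"
  have s0: "cmod s > 0" using r s by linarith
  then have u: "cmod u = 1" by (simp add: u_def norm_divide)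
  have s_u: "s = of_real (cmod s) * u" using s0 by (simp add: u_def)
  have "s - u = of_real (cmod s - 1) * u" using s_u by (simp add: algebra_simps)
  then have 1: "cmod (s - u) = 1 - cmod s" 
    using u s by (metis abs_minus_commute abs_of_nonneg diff_ge_0_iff_ge mult.right_neutral norm_mult norm_of_real)
  have "1/s - 1/u = of_real (1 - cmod s) / s" using s0 by (simp add: u_def diff_divide_distrib)
  then have "cmod (1/s - 1/u) = (1 - cmod s) / cmod s" using s by (simp add: norm_divide del: of_real_diff)
  then have 2: "cmod (1/s - 1/u) = 1 / cmod s - 1" using s0 by (simp add: diff_divide_distrib)
  have "joukowski \<rho> s - joukowski \<rho> u = of_real \<rho> * (s - u) + (1/s - 1/u)"
    by (simp add: joukowski_def algebra_simps)
  then have "cmod (joukowski \<rho> s - joukowski \<rho> u) \<le> \<bar>\<rho>\<bar> * cmod (s - u) + cmod (1/s - 1/u)"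
    by (metis norm_mult norm_of_real norm_triangle_ineq)
  also have "\<dots> \<le> (1 - cmod s) + (1 / cmod s - 1)"
    using 1 2 \<rho> s mult_right_mono[of "\<bar>\<rho>\<bar>" 1 "1 - cmod s"] by simp
  also have "\<dots> \<le> 1 / r - r" using s r frac_le[of 1 1 r "cmod s"] by simp
  also have "\<dots> \<le> \<delta>" by fact
  finally have "dist (joukowski \<rho> s) (joukowski \<rho> u) \<le> \<delta>" by (simp add: dist_norm)
  then show ?thesis unfolding ellipsoid_nbhd_eq[OF \<rho>]
    using infdist_le2[OF joukowski_unit_circle_in_closed_ellipse[OF u]] by blast
qed

lemma deriv_joukowski: "s \<noteq> 0 \<Longrightarrow> deriv (joukowski \<rho>) s = of_real \<rho> - 1 / s\<^sup>2"
  unfolding joukowski_def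
  by (rule DERIV_imp_deriv) (auto intro!: derivative_eq_intros simp: field_simps power2_eq_square)

lemma valid_path_joukowski_circle: 
  assumes "0 < r" shows "valid_path (joukowski \<rho> \<circ> circlepath 0 r)"
  by (rule valid_path_compose_holomorphic[OF _ holomorphic_on_joukowski[of "- {0}"]])
     (use assms in auto)

lemma contour_integral_joukowski_circle:
  assumes "0 < r"
  shows "contour_integral (joukowski \<rho> \<circ> circlepath 0 r) h =
         contour_integral (circlepath 0 r) (\<lambda>s. h (joukowski \<rho> s) * deriv (joukowski \<rho>) s)"
proof -
  have "joukowski \<rho> analytic_on (- {0})"
    using holomorphic_on_joukowski[of "- {0}" \<rho>] by (subst analytic_on_open) auto
  then show ?thesis
    by (subst contour_integral_comp_analyticW[of _ "- {0}"]) (use assms in \<open>auto simp: mult.commute\<close>)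
qed

text \<open>
  The logarithmic derivative of \<open>joukowski \<rho> s - p = (\<rho> s\<^sup>2 - p s + 1) / s\<close> is integrated over the circle.
  The pole at \<open>0\<close> contributes \<open>-1\<close>. For \<open>p\<close> in the ellipse the numerator has no zero in the disc; for
  \<open>p = joukowski \<rho> \<sigma>\<close> it is \<open>(s - \<sigma>) (\<rho> s - 1 / \<sigma>)\<close>, which has exactly the zero \<open>\<sigma>\<close> there and so cancels the
  contribution of the pole.
\<close>

lemma winding_number_joukowski_circle:
  assumes \<rho>: "\<bar>\<rho>\<bar> \<le> 1" and r: "0 < r" "r < 1"
  shows "p \<in> closed_ellipse \<rho> \<Longrightarrow> winding_number (joukowski \<rho> \<circ> circlepath 0 r) p = - 1"
    and "0 < cmod \<sigma> \<Longrightarrow> cmod \<sigma> < r \<Longrightarrow>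
           winding_number (joukowski \<rho> \<circ> circlepath 0 r) (joukowski \<rho> \<sigma>) = 0"
proof -
  have wn: "winding_number (joukowski \<rho> \<circ> circlepath 0 r) p = i / (2 * pi * \<i>)"
    if "p \<notin> joukowski \<rho> ` sphere 0 r"
      "((\<lambda>s. deriv (joukowski \<rho>) s / (joukowski \<rho> s - p)) has_contour_integral i) (circlepath 0 r)" for p i
  proof -
    have "p \<notin> path_image (joukowski \<rho> \<circ> circlepath 0 r)" 
      using that(1) r by (simp add: path_image_compose)
    then have "winding_number (joukowski \<rho> \<circ> circlepath 0 r) p = 1 / (2 * pi * \<i>) *
        contour_integral (joukowski \<rho> \<circ> circlepath 0 r) (\<lambda>w. 1 / (w - p))"
      using valid_path_joukowski_circle[OF r(1)] by (intro winding_number_valid_path) auto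
    also have "contour_integral (joukowski \<rho> \<circ> circlepath 0 r) (\<lambda>w. 1 / (w - p)) = i"
      using contour_integral_unique[OF that(2)] by (simp add: contour_integral_joukowski_circle[OF r(1)])
    finally show ?thesis by (simp only: mult_1 times_divide_eq_left)
  qed
  have sphere: "s \<noteq> 0 \<and> cmod s < 1" if "s \<in> sphere 0 r" for s using that r by auto
  have circ: "((\<lambda>s. 1 / (s - \<sigma>)) has_contour_integral 2 * of_real pi * \<i>) (circlepath 0 r)" if "cmod \<sigma> < r" for \<sigma>
    using Cauchy_integral_circlepath_simple[of "\<lambda>_. 1" 0 r \<sigma>] that by simp
  have circ0: "((\<lambda>s. 1 / (s - 0)) has_contour_integral 2 * of_real pi * \<i>) (circlepath 0 r)"
    by (rule circ) (use r in simp)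
  have disc: "(f has_contour_integral 0) (circlepath 0 r)" if "f holomorphic_on ball 0 1" for f
    by (rule Cauchy_theorem_disc_simple[OF that]) (use r in auto)
  show "winding_number (joukowski \<rho> \<circ> circlepath 0 r) p = - 1" if p: "p \<in> closed_ellipse \<rho>" 
  proof -
    define q where "q = (\<lambda>s. of_real \<rho> * s\<^sup>2 - p * s + 1)"
    have q0: "q s \<noteq> 0" if "cmod s < 1" for s
    proof
      assume "q s = 0"
      moreover from this have "s \<noteq> 0" by (auto simp: q_def)
      ultimately have "p = joukowski \<rho> s" by (simp add: q_def joukowski_def field_simps power2_eq_square)
      then show False using p joukowski_notin_closed_ellipse[OF \<rho> \<open>s \<noteq> 0\<close> that] by simp
    qed
    have "((\<lambda>s. (2 * of_real \<rho> * s - p) / q s - 1 / (s - 0)) has_contour_integral (0 - 2 * of_real pi * \<i>)) (circlepath 0 r)"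
      by (intro has_contour_integral_diff disc circ0) 
         (use q0 r in \<open>auto simp: q_def intro!: holomorphic_intros\<close>)
    then have "((\<lambda>s. deriv (joukowski \<rho>) s / (joukowski \<rho> s - p)) has_contour_integral (0 - 2 * of_real pi * \<i>)) (circlepath 0 r)"
    proof (rule has_contour_integral_eq)
      fix s assume "s \<in> path_image (circlepath 0 r)"
      then have s: "s \<noteq> 0" "cmod s < 1" using sphere r by auto
      have j: "joukowski \<rho> s - p = q s / s" using s by (simp add: joukowski_def q_def field_simps power2_eq_square)
      have "(2 * of_real \<rho> * s - p) / q s - 1 / (s - 0) = ((2 * of_real \<rho> * s - p) * s - q s) / (q s * s)"
        using q0[OF s(2)] s by (simp add: diff_divide_distrib)
      also have "(2 * of_real \<rho> * s - p) * s - q s = of_real \<rho> * s\<^sup>2 - 1"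
        by (simp add: q_def algebra_simps power2_eq_square)
      also have "(of_real \<rho> * s\<^sup>2 - 1) / (q s * s) = (of_real \<rho> - 1 / s\<^sup>2) / (q s / s)"
        using q0[OF s(2)] s by (simp add: field_simps power2_eq_square)
      finally show "(2 * of_real \<rho> * s - p) / q s - 1 / (s - 0) = deriv (joukowski \<rho>) s / (joukowski \<rho> s - p)"
        using s by (simp add: deriv_joukowski j)
    qed
    moreover have "p \<notin> joukowski \<rho> ` sphere 0 r"
      using p sphere joukowski_notin_closed_ellipse[OF \<rho>] by blast
    ultimately show ?thesis by (subst wn) auto
  qed
  show "winding_number (joukowski \<rho> \<circ> circlepath 0 r) (joukowski \<rho> \<sigma>) = 0" if \<sigma>: "0 < cmod \<sigma>" "cmod \<sigma> < r"
  proof -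
    have n0: "of_real \<rho> * s - 1 / \<sigma> \<noteq> 0" if "cmod s < 1" for s
    proof
      assume "of_real \<rho> * s - 1 / \<sigma> = 0"
      then have "cmod (of_real \<rho> * s) = 1 / cmod \<sigma>" by (simp add: norm_divide)
      moreover have "1 / cmod \<sigma> > 1" using \<sigma> r by simp
      ultimately show False using cmod_of_real_mult_less_1[OF \<rho> that] by linarith
    qed
    have "((\<lambda>s. (1 / (s - \<sigma>) + of_real \<rho> / (of_real \<rho> * s - 1 / \<sigma>)) - 1 / (s - 0)) has_contour_integral 
        ((2 * of_real pi * \<i> + 0) - 2 * of_real pi * \<i>)) (circlepath 0 r)"
      by (intro has_contour_integral_diff has_contour_integral_add disc circ0 circ) 
         (use n0 r \<sigma> in \<open>auto intro!: holomorphic_intros\<close>)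
    then have "((\<lambda>s. deriv (joukowski \<rho>) s / (joukowski \<rho> s - joukowski \<rho> \<sigma>)) has_contour_integral 
        ((2 * of_real pi * \<i> + 0) - 2 * of_real pi * \<i>)) (circlepath 0 r)"
    proof (rule has_contour_integral_eq)
      fix s assume "s \<in> path_image (circlepath 0 r)"
      then have s: "s \<noteq> 0" "cmod s < 1" "s \<noteq> \<sigma>" using sphere r \<sigma> by auto
      have \<sigma>0: "\<sigma> \<noteq> 0" using \<sigma> by auto
      define A B where "A = s - \<sigma>" and "B = of_real \<rho> * s - 1 / \<sigma>"
      have nz: "A \<noteq> 0" "B \<noteq> 0" "s \<noteq> 0" using s n0[OF s(2)] by (auto simp: A_def B_def)
      have inv: "\<sigma> * (1 / \<sigma>) = 1" "1 / s * s = 1" using \<sigma>0 s by simp_all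
      have "(joukowski \<rho> s - joukowski \<rho> \<sigma>) * s = of_real \<rho> * s * (s - \<sigma>) + 1 / s * s - 1 / \<sigma> * s"
        unfolding joukowski_def by (simp only: algebra_simps)
      also have "\<dots> = of_real \<rho> * s * (s - \<sigma>) + \<sigma> * (1 / \<sigma>) - 1 / \<sigma> * s" unfolding inv ..
      also have "\<dots> = A * B" unfolding A_def B_def by (simp only: algebra_simps)
      finally have j: "joukowski \<rho> s - joukowski \<rho> \<sigma> = A * B / s" using s(1) by (simp add: eq_divide_eq)
      have "B * s + of_real \<rho> * A * s - A * B = of_real \<rho> * s\<^sup>2 - \<sigma> * (1 / \<sigma>)"
        unfolding A_def B_def by (simp only: algebra_simps power2_eq_square)
      then have num: "B * s + of_real \<rho> * A * s - A * B = of_real \<rho> * s\<^sup>2 - 1"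
        unfolding inv(1) .
      have "1 / A + of_real \<rho> / B - 1 / s = (B * s + of_real \<rho> * A * s - A * B) / (A * B * s)"
        using nz by (simp add: field_simps)
      also have "\<dots> = (of_real \<rho> * s\<^sup>2 - 1) / (A * B * s)" unfolding num ..
      also have "\<dots> = (of_real \<rho> - 1 / s\<^sup>2) / (A * B / s)"
        using nz by (simp add: field_simps power2_eq_square)
      finally have fin: "1 / A + of_real \<rho> / B - 1 / s = (of_real \<rho> - 1 / s\<^sup>2) / (A * B / s)" .
      show "1 / (s - \<sigma>) + of_real \<rho> / (of_real \<rho> * s - 1 / \<sigma>) - 1 / (s - 0) =
          deriv (joukowski \<rho>) s / (joukowski \<rho> s - joukowski \<rho> \<sigma>)"
        unfolding j deriv_joukowski[OF s(1)] using fin by (simp only: A_def B_def diff_zero)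
    qed
    moreover have "joukowski \<rho> \<sigma> \<notin> joukowski \<rho> ` sphere 0 r"
    proof
      assume "joukowski \<rho> \<sigma> \<in> joukowski \<rho> ` sphere 0 r"
      then obtain s where s: "s \<in> sphere 0 r" "joukowski \<rho> \<sigma> = joukowski \<rho> s" by blast
      have "- \<sigma> = m_fun \<rho> (joukowski \<rho> \<sigma>)" using m_fun_joukowski[OF \<rho>, of \<sigma>] \<sigma> r by simp
      also have "\<dots> = - s" unfolding s(2) using m_fun_joukowski[OF \<rho>, of s] sphere[OF s(1)] by simp
      finally have "\<sigma> = s" by simp
      then show False using s(1) \<sigma> by simp
    qed
    ultimately show ?thesis by (subst wn) auto
  qed
qed

text \<open>
  The segment from a boundary point \<open>z0\<close> towards its nearest point \<open>p\<close> of the ellipse stays in the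
  neighbourhood and avoids the ellipse until it reaches \<open>p\<close>. Close to \<open>p\<close> its preimage has modulus at
  least \<open>r\<close>, since \<open>\<rho> s\<^sup>2 - p s + 1\<close> is bounded away from zero for \<open>\<bar>s\<bar> \<le> r\<close>; so the segment meets the
  image of the annulus \<open>r \<le> \<bar>s\<bar> < 1\<close>.
\<close>

lemma boundary_joined_to_joukowski_circle:
  assumes \<rho>: "\<bar>\<rho>\<bar> \<le> 1" and \<delta>: "\<delta> > 0" and r: "0 < r" "r < 1" "1 / r - r \<le> \<delta>"
    and z0: "z0 \<in> frontier (ellipsoid_nbhd \<rho> \<delta>)" and s0: "cmod s0 = r"
  obtains T where "connected T" "T \<subseteq> ellipsoid_nbhd \<rho> \<delta> - closed_ellipse \<rho>" "z0 \<in> T" "joukowski \<rho> s0 \<in> T"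
proof -
  let ?E = "closed_ellipse \<rho>" and ?K = "ellipsoid_nbhd \<rho> \<delta>"
  note z0' = frontier_ellipsoid_nbhd[OF \<rho> z0]
  obtain p where p: "p \<in> ?E" "dist z0 p = \<delta>"
    using closed_ellipse_nearest_point[of \<rho> z0] z0'(2) by metis
  have pK: "p \<in> ?K" using p closed_ellipse_subset_interior[OF \<rho> \<delta>] interior_subset by blast
  define q where "q = (\<lambda>s. of_real \<rho> * s\<^sup>2 - p * s + 1)"
  have q0: "q s \<noteq> 0" if "cmod s < 1" for s
  proof
    assume "q s = 0"
    moreover from this have "s \<noteq> 0" by (auto simp: q_def)
    ultimately have "p = joukowski \<rho> s" by (simp add: q_def joukowski_def field_simps power2_eq_square)
    then show False using p joukowski_notin_closed_ellipse[OF \<rho> \<open>s \<noteq> 0\<close> that] by simp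
  qed
  have "continuous_on (cball 0 r) (\<lambda>s. cmod (q s))" unfolding q_def by (intro continuous_intros)
  then obtain s1 where s1: "s1 \<in> cball 0 r" "\<And>s. s \<in> cball 0 r \<Longrightarrow> cmod (q s1) \<le> cmod (q s)"
    using continuous_attains_inf[of "cball 0 r" "\<lambda>s. cmod (q s)"] r by fastforce
  define \<epsilon> where "\<epsilon> = cmod (q s1)"
  have \<epsilon>: "\<epsilon> > 0" using q0[of s1] s1(1) r by (simp add: \<epsilon>_def)
  \<comment> \<open>The choice makes \<open>z1\<close> below closer to \<open>p\<close> than the lower bound \<open>\<epsilon>\<close> on \<open>\<rho> s\<^sup>2 - p s + 1\<close>.\<close>
  define t where "t = min (1/2) (\<epsilon> / (2 * \<delta>))"
  have t: "0 < t" "t < 1" "t * \<delta> < \<epsilon>"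
    using \<epsilon> \<delta> by (auto simp: t_def min_def field_simps)
  define z1 where "z1 = p + t *\<^sub>R (z0 - p)"
  have seg: "z \<in> ?K - ?E" if z: "z \<in> closed_segment z0 z1" for z
  proof -
    obtain u where u: "0 \<le> u" "u \<le> 1" "z = (1 - u) *\<^sub>R z0 + u *\<^sub>R z1"
      using z unfolding in_segment by blast
    define v where "v = u * (1 - t)"
    have "v \<le> 1 * (1 - t)" unfolding v_def using u t by (intro mult_right_mono) auto
    moreover have "0 \<le> v" unfolding v_def using u t by (intro mult_nonneg_nonneg) auto
    ultimately have v: "0 \<le> v" "v < 1" using t by auto
    have zv: "z = (1 - v) *\<^sub>R z0 + v *\<^sub>R p" 
      by (simp add: u(3) z1_def v_def algebra_simps)
    have "z \<in> ?K"
      using compact_convex_ellipsoid_nbhd(2)[OF \<rho>] z0'(1) pK v unfolding zv convex_alt by auto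
    moreover have "z \<notin> ?E"
    proof
      assume "z \<in> ?E"
      then have "\<delta> \<le> dist z0 z" using z0'(2) infdist_le by metis
      also have "dist z0 z = v * \<delta>"
      proof -
        have "z0 - z = v *\<^sub>R (z0 - p)" by (simp add: zv algebra_simps)
        then show ?thesis using v p(2) by (simp add: dist_norm)
      qed
      finally have "\<delta> \<le> v * \<delta>" .
      moreover have "v * \<delta> < 1 * \<delta>" using v \<delta> by (intro mult_strict_right_mono) auto
      ultimately show False by simp
    qed
    ultimately show ?thesis by blast
  qed
  obtain s where s: "s \<noteq> 0" "cmod s < 1" "z1 = joukowski \<rho> s"
    using outside_closed_ellipse_joukowski[OF \<rho>] seg[of z1] by blast
  have "r \<le> cmod s"
  proof (rule ccontr)
    assume "\<not> r \<le> cmod s"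
    then have "\<epsilon> \<le> cmod (q s)" unfolding \<epsilon>_def by (intro s1) simp
    also have "q s = (z1 - p) * s"
      using s by (simp add: s(3) q_def joukowski_def field_simps power2_eq_square)
    also have "cmod ((z1 - p) * s) = t * \<delta> * cmod s"
      using t p(2) by (simp add: norm_mult z1_def dist_norm)
    also have "\<dots> \<le> t * \<delta>" using s(2) t \<delta> by (simp add: mult_left_le)
    finally show False using t by simp
  qed
  define A where "A = {s :: complex. r \<le> cmod (s - 0) \<and> cmod (s - 0) < 1}"
  have "connected A" unfolding A_def by (rule connected_annulus) simp
  then have cA: "connected (joukowski \<rho> ` A)"
    by (rule connected_continuous_image[rotated]) 
       (use r in \<open>auto intro!: holomorphic_on_imp_continuous_on holomorphic_on_joukowski simp: A_def\<close>)
  show ?thesis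
  proof (rule that)
    have "z1 \<in> joukowski \<rho> ` A" using s \<open>r \<le> cmod s\<close> by (auto simp: A_def)
    then show "connected (closed_segment z0 z1 \<union> joukowski \<rho> ` A)"
      using cA by (intro connected_Un) auto
    have "joukowski \<rho> x \<in> ?K - ?E" if "x \<in> A" for x
    proof -
      have "x \<noteq> 0" "r \<le> cmod x" "cmod x < 1" using that r(1) by (auto simp: A_def)
      then show ?thesis
        using joukowski_annulus_in_nbhd[OF \<rho> r(1,3), of x] joukowski_notin_closed_ellipse[OF \<rho>, of x] by simp
    qed
    then have "joukowski \<rho> ` A \<subseteq> ?K - ?E" by blast
    then show "closed_segment z0 z1 \<union> joukowski \<rho> ` A \<subseteq> ?K - ?E" using seg by blast
    show "joukowski \<rho> s0 \<in> closed_segment z0 z1 \<union> joukowski \<rho> ` A" using s0 r by (auto simp: A_def)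
  qed auto
qed

text \<open>
  The boundary contour winds once, in one of the two directions, around the ellipse and not around any point
  outside the neighbourhood; the image of the circle does the same in the clockwise direction. Hence the
  two are homologous up to the sign \<open>\<eta>\<close>, which depends on the orientation only. Since the boundary contour
  is used twice in the covariance, only \<open>\<eta>\<^sup>2 = 1\<close> will matter.
\<close>

lemma boundary_contour_integral_eq_circle:
  assumes \<rho>: "\<bar>\<rho>\<bar> \<le> 1" and \<delta>: "\<delta> > 0" and r: "0 < r" "r < 1" "1 / r - r \<le> \<delta>"
    and C: "boundary_contour \<rho> \<delta> C"
  shows "\<exists>\<eta> :: complex. \<eta>\<^sup>2 = 1 \<and> (\<forall>U h. open U \<longrightarrow> ellipsoid_nbhd \<rho> \<delta> \<subseteq> U \<longrightarrow>
       h holomorphic_on U - closed_ellipse \<rho> \<longrightarrow> contour_integral C h =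
       \<eta> * contour_integral (circlepath 0 r) (\<lambda>s. h (joukowski \<rho> s) * deriv (joukowski \<rho>) s))"
proof -
  let ?E = "closed_ellipse \<rho>" and ?K = "ellipsoid_nbhd \<rho> \<delta>"
  define D where "D = joukowski \<rho> \<circ> circlepath 0 r"
  have C: "valid_path C" "simple_path C" "pathfinish C = pathstart C" "path_image C = frontier ?K"
    using C by (auto simp: boundary_contour_def)
  have vD: "valid_path D" unfolding D_def by (rule valid_path_joukowski_circle[OF r(1)])
  have imD: "path_image D = joukowski \<rho> ` sphere 0 r"
    using r by (simp add: D_def path_image_compose)
  have imDK: "path_image D \<subseteq> ?K - ?E" unfolding imD
    using joukowski_annulus_in_nbhd[OF \<rho> r(1,3)] joukowski_notin_closed_ellipse[OF \<rho>] r by auto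
  have loopD: "pathfinish D = pathstart D" by (simp add: D_def pathfinish_compose pathstart_compose)
  have startD: "pathstart D = joukowski \<rho> (of_real r)" by (simp add: D_def pathstart_compose)
  have imC: "path_image C \<subseteq> ?K - ?E"
    using frontier_ellipsoid_nbhd[OF \<rho>, of _ \<delta>] \<delta> C(4) by fastforce
  have "inside (path_image C) = interior ?K"
    using compact_convex_ellipsoid_nbhd[OF \<rho>] C(4) by (simp add: inside_frontier_eq_interior compact_imp_bounded)
  then have ins: "?E \<subseteq> inside (path_image C)" using closed_ellipse_subset_interior[OF \<rho> \<delta>] by simp
  obtain n :: complex where n: "n\<^sup>2 = 1" "n = 1 \<or> n = -1" "\<And>z. z \<in> ?E \<Longrightarrow> winding_number C z = n"
    using simple_closed_path_winding_number_inside[OF C(2)] ins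
    by (metis (no_types, lifting) one_power2 power2_minus subsetD)
  have outC: "winding_number C w = 0" if "w \<notin> ?K" for w
    using winding_number_zero_outside[of C ?K w] compact_convex_ellipsoid_nbhd(2)[OF \<rho>] C imC that
    by (auto intro: valid_path_imp_path)
  have outD: "winding_number D w = 0" if w: "w \<notin> ?K" for w
  proof -
    have "w \<notin> ?E" using w closed_ellipse_subset_interior[OF \<rho> \<delta>] interior_subset by blast
    then obtain \<sigma> where \<sigma>: "\<sigma> \<noteq> 0" "cmod \<sigma> < 1" "w = joukowski \<rho> \<sigma>"
      using outside_closed_ellipse_joukowski[OF \<rho>] by blast
    then have "cmod \<sigma> < r" using joukowski_annulus_in_nbhd[OF \<rho> r(1,3), of \<sigma>] w by force
    then show ?thesis unfolding D_def \<sigma>(3) using \<sigma> by (intro winding_number_joukowski_circle[OF \<rho> r(1,2)]) auto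
  qed
  have inD: "winding_number D w = -1" if "w \<in> ?E" for w
    unfolding D_def using that by (rule winding_number_joukowski_circle[OF \<rho> r(1,2)])
  obtain T where T: "connected T" "T \<subseteq> ?K - ?E" "pathstart C \<in> T" "pathstart D \<in> T"
    using boundary_joined_to_joukowski_circle[OF \<rho> \<delta> r, of "pathstart C" "of_real r"] C(4) startD r
    by (metis norm_of_real abs_of_pos pathstart_in_path_image)
  show ?thesis
  proof (intro exI[of _ "- n"] conjI allI impI)
    show "(- n)\<^sup>2 = 1" using n(1) by simp
    fix U h assume U: "open U" "?K \<subseteq> U" and h: "h holomorphic_on U - ?E"
    have S: "open (U - ?E)" using U compact_closed_ellipse compact_imp_closed by (intro open_Diff) blast+
    have CS: "path_image C \<subseteq> U - ?E" and DS: "path_image D \<subseteq> U - ?E" and TS: "T \<subseteq> U - ?E" 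
      using imC imDK T U by blast+
    have "contour_integral C h = - n * contour_integral D h"
    proof (cases "n = 1")
      case True
      have "contour_integral C h = contour_integral (reversepath D) h"
      proof (rule homologous_loops_contour_integral_eq[OF S h _ _ CS _ _ _ T(1) TS])
        fix w assume w: "w \<notin> U - ?E"
        have pD: "path D" "w \<notin> path_image D" using vD DS w by (auto intro: valid_path_imp_path)
        consider "w \<in> ?E" | "w \<notin> ?K" using w U by blast
        then show "winding_number C w = winding_number (reversepath D) w"
          using n(3)[of w] True inD[of w] outC[of w] outD[of w] pD
          by cases (simp_all add: winding_number_reversepath)
      qed (use C vD loopD DS T in auto)
      then show ?thesis using True vD by (simp add: contour_integral_reversepath)
    next
      case False
      then have n': "n = -1" using n(2) by simp
      have "contour_integral C h = contour_integral D h"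
      proof (rule homologous_loops_contour_integral_eq[OF S h _ _ CS _ _ _ T(1) TS])
        fix w assume w: "w \<notin> U - ?E"
        consider "w \<in> ?E" | "w \<notin> ?K" using w U by blast
        then show "winding_number C w = winding_number D w"
          using n(3)[of w] n' inD[of w] outC[of w] outD[of w] by cases simp_all
      qed (use C vD loopD DS T in auto)
      then show ?thesis using n' by simp
    qed
    then show "contour_integral C h = - n * contour_integral (circlepath 0 r) (\<lambda>s. h (joukowski \<rho> s) * deriv (joukowski \<rho>) s)"
      by (simp add: D_def contour_integral_joukowski_circle[OF r(1)])
  qed
qed

section \<open>The covariance kernel and its power series\<close>

text \<open>
  If \<open>H p\<close> is the product \<open>m(z) m(w) \<beta>(z, w)\<close> written as a function of \<open>p = m(z) m(w)\<close>, this is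
  \<open>(p H'(p))'\<close>, the factor of \<open>m'(z) m'(w)\<close> in the mixed derivative.
\<close>

definition covariance_kernel :: "real \<Rightarrow> real \<Rightarrow> real \<Rightarrow> complex \<Rightarrow> complex" where
  "covariance_kernel \<rho> s2 \<kappa> p =
     of_real (s2 - \<rho> - 1) + of_real \<rho> / (1 - of_real \<rho> * p)\<^sup>2 + 1 / (1 - p)\<^sup>2
     + of_real (2 * (\<kappa> - 2 * \<rho>\<^sup>2 - 1)) * p"

text \<open>
  The Taylor coefficients of \<open>covariance_kernel\<close>. The index is shifted by one against the
  coefficients \<open>a\<^sub>l\<close>, so \<open>l = 0\<close> and \<open>l = 1\<close> carry the corrections for \<open>a\<^sub>1\<close> and \<open>a\<^sub>2\<close>.
\<close>

definition kernel_coeff :: "real \<Rightarrow> real \<Rightarrow> real \<Rightarrow> nat \<Rightarrow> complex" where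
  "kernel_coeff \<rho> s2 \<kappa> l = of_nat (Suc l) * (1 + of_real \<rho> ^ Suc l)
     + (if l = 0 then of_real (s2 - \<rho> - 1) else 0)
     + (if l = 1 then of_real (2 * (\<kappa> - 2 * \<rho>\<^sup>2 - 1)) else 0)"

lemma one_minus_neq_0: "cmod p < 1 \<Longrightarrow> 1 - p \<noteq> 0"
  by auto

lemma one_minus_notin_nonpos_Reals: "cmod p < 1 \<Longrightarrow> 1 - p \<notin> \<real>\<^sub>\<le>\<^sub>0"
  using complex_Re_le_cmod[of p] by (auto simp: complex_nonpos_Reals_iff)

lemma upsilon_fun_eq_kernel:
  assumes \<rho>: "\<bar>\<rho>\<bar> \<le> 1" and z: "z \<notin> closed_ellipse \<rho>" and w: "w \<notin> closed_ellipse \<rho>"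
  shows "upsilon_fun \<rho> s2 \<kappa> z w =
    deriv (m_fun \<rho>) z * deriv (m_fun \<rho>) w * covariance_kernel \<rho> s2 \<kappa> (m_fun \<rho> z * m_fun \<rho> w)"
proof -
  let ?m = "m_fun \<rho>" and ?D = "- closed_ellipse \<rho>"
  define a c :: complex where "a = of_real (s2 - \<rho> - 1)" and "c = of_real ((\<kappa> - 2 * \<rho>\<^sup>2 - 1) / 2)"
  define H where "H = (\<lambda>p. a * p - Ln (1 - of_real \<rho> * p) - Ln (1 - p) + c * p\<^sup>2)"
  define H1 where "H1 = (\<lambda>p. a + of_real \<rho> / (1 - of_real \<rho> * p) + 1 / (1 - p) + 2 * c * p)"
  have D: "open ?D" using compact_closed_ellipse compact_imp_closed by blast
  have m': "(?m has_field_derivative deriv ?m u) (at u)" if "u \<in> ?D" for u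
    using holomorphic_derivI[OF holomorphic_on_m_fun[OF \<rho>] D that] by simp
  have mm: "cmod (?m u * ?m v) < 1" if "u \<in> ?D" "v \<in> ?D" for u v
    using m_fun_outside(2)[OF \<rho>] that mult_strict_mono[of "cmod (?m u)" 1 "cmod (?m v)" 1]
    by (simp add: norm_mult)
  have H: "(H has_field_derivative H1 p) (at p)" if p: "cmod p < 1" for p
  proof -
    note pp = p cmod_of_real_mult_less_1[OF \<rho> p]
    show ?thesis unfolding H_def H1_def
      using pp[THEN one_minus_notin_nonpos_Reals] pp[THEN one_minus_neq_0]
      by (auto intro!: derivative_eq_intros simp: divide_inverse)
  qed
  have inner: "deriv (\<lambda>w'. ?m z' * ?m w' * beta_fun \<rho> s2 \<kappa> z' w') w = ?m z' * deriv ?m w * H1 (?m z' * ?m w)"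
    if z': "z' \<in> ?D" for z'
  proof (rule DERIV_imp_deriv, rule has_field_derivative_transform_within_open)
    have "((\<lambda>w'. H (?m z' * ?m w')) has_field_derivative H1 (?m z' * ?m w) * (?m z' * deriv ?m w)) (at w)"
      using DERIV_chain2[OF H[OF mm[OF z', of w]] DERIV_cmult[OF m'[of w]]] w by simp
    then show "((\<lambda>w'. H (?m z' * ?m w')) has_field_derivative ?m z' * deriv ?m w * H1 (?m z' * ?m w)) (at w)"
      by (simp add: mult_ac)
    fix w' assume w': "w' \<in> ?D"
    have "?m z' \<noteq> 0" "?m w' \<noteq> 0" using m_fun_outside(1)[OF \<rho>] z' w' by auto
    then show "H (?m z' * ?m w') = ?m z' * ?m w' * beta_fun \<rho> s2 \<kappa> z' w'"
      by (simp add: H_def beta_fun_def a_def c_def field_simps power2_eq_square)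
  qed (use D w in auto)
  have "deriv (\<lambda>z'. deriv (\<lambda>w'. ?m z' * ?m w' * beta_fun \<rho> s2 \<kappa> z' w') w) z =
      deriv ?m z * deriv ?m w * covariance_kernel \<rho> s2 \<kappa> (?m z * ?m w)"
  proof (rule DERIV_imp_deriv, rule has_field_derivative_transform_within_open)
    define p where "p = ?m z * ?m w"
    have p: "cmod p < 1" unfolding p_def using mm z w by simp
    note pp = p cmod_of_real_mult_less_1[OF \<rho> p]
    note nz = pp[THEN one_minus_neq_0]
    have "(H1 has_field_derivative (of_real \<rho>)\<^sup>2 / (1 - of_real \<rho> * p)\<^sup>2 + 1 / (1 - p)\<^sup>2 + 2 * c) (at p)"
      unfolding H1_def using nz by (auto intro!: derivative_eq_intros simp: power2_eq_square)
    then have "((\<lambda>z'. H1 (?m z' * ?m w)) has_field_derivative 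
        ((of_real \<rho>)\<^sup>2 / (1 - of_real \<rho> * p)\<^sup>2 + 1 / (1 - p)\<^sup>2 + 2 * c) * (deriv ?m z * ?m w)) (at z)"
      unfolding p_def using z by (intro DERIV_chain2[where f=H1] DERIV_cmult_right m') auto
    then have "((\<lambda>z'. ?m z' * deriv ?m w * H1 (?m z' * ?m w)) has_field_derivative 
        (deriv ?m z * deriv ?m w) * H1 (?m z * ?m w) +
        ((of_real \<rho>)\<^sup>2 / (1 - of_real \<rho> * p)\<^sup>2 + 1 / (1 - p)\<^sup>2 + 2 * c) * (deriv ?m z * ?m w) * (?m z * deriv ?m w)) (at z)"
      using z by (intro DERIV_mult DERIV_cmult_right m') auto
    also have "(deriv ?m z * deriv ?m w) * H1 (?m z * ?m w) +
        ((of_real \<rho>)\<^sup>2 / (1 - of_real \<rho> * p)\<^sup>2 + 1 / (1 - p)\<^sup>2 + 2 * c) * (deriv ?m z * ?m w) * (?m z * deriv ?m w) =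
        deriv ?m z * deriv ?m w * (H1 p + p * ((of_real \<rho>)\<^sup>2 / (1 - of_real \<rho> * p)\<^sup>2 + 1 / (1 - p)\<^sup>2 + 2 * c))"
      by (simp add: p_def algebra_simps)
    also have "H1 p + p * ((of_real \<rho>)\<^sup>2 / (1 - of_real \<rho> * p)\<^sup>2 + 1 / (1 - p)\<^sup>2 + 2 * c) = covariance_kernel \<rho> s2 \<kappa> p"
    proof -
      have split: "x / (1 - x * p) + p * (x\<^sup>2 / (1 - x * p)\<^sup>2) = x / (1 - x * p)\<^sup>2" if "1 - x * p \<noteq> 0" for x :: complex
      proof -
        have "x / (1 - x * p) = x * (1 - x * p) / (1 - x * p)\<^sup>2" using that by (simp add: power2_eq_square)
        then have "x / (1 - x * p) + p * (x\<^sup>2 / (1 - x * p)\<^sup>2) = (x * (1 - x * p) + p * x\<^sup>2) / (1 - x * p)\<^sup>2"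
          by (simp add: add_divide_distrib)
        also have "x * (1 - x * p) + p * x\<^sup>2 = x" by (simp add: algebra_simps power2_eq_square)
        finally show ?thesis .
      qed
      have "H1 p + p * ((of_real \<rho>)\<^sup>2 / (1 - of_real \<rho> * p)\<^sup>2 + 1 / (1 - p)\<^sup>2 + 2 * c) =
         a + (of_real \<rho> / (1 - of_real \<rho> * p) + p * ((of_real \<rho>)\<^sup>2 / (1 - of_real \<rho> * p)\<^sup>2)) 
         + (1 / (1 - 1 * p) + p * (1\<^sup>2 / (1 - 1 * p)\<^sup>2)) + 4 * c * p"
        by (simp add: H1_def algebra_simps)
      also have "\<dots> = covariance_kernel \<rho> s2 \<kappa> p"
        using nz by (subst (1 2) split) (simp_all add: covariance_kernel_def a_def c_def)
      finally show ?thesis .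
    qed
    finally show "((\<lambda>z'. ?m z' * deriv ?m w * H1 (?m z' * ?m w)) has_field_derivative 
        deriv ?m z * deriv ?m w * covariance_kernel \<rho> s2 \<kappa> (?m z * ?m w)) (at z)"
      by (simp add: p_def)
  qed (use D z inner in auto)
  then show ?thesis by (simp add: upsilon_fun_def)
qed

lemma covariance_kernel_sums:
  assumes \<rho>: "\<bar>\<rho>\<bar> \<le> 1" and p: "cmod p < 1"
  shows "(\<lambda>l. kernel_coeff \<rho> s2 \<kappa> l * p ^ l) sums covariance_kernel \<rho> s2 \<kappa> p"
proof -
  define a d :: complex where "a = of_real (s2 - \<rho> - 1)" and "d = of_real (2 * (\<kappa> - 2 * \<rho>\<^sup>2 - 1))"
  have "(\<lambda>l. (if l = 0 then a * p ^ l else 0) + of_real \<rho> * (of_nat (Suc l) * (of_real \<rho> * p) ^ l) + of_nat (Suc l) * p ^ l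
      + (if l = 1 then d * p ^ l else 0)) sums
      (a * p ^ 0 + of_real \<rho> * (1 / (1 - of_real \<rho> * p)\<^sup>2) + 1 / (1 - p)\<^sup>2 + d * p ^ 1)"
    by (intro sums_add sums_mult geometric_deriv_sums cmod_of_real_mult_less_1 \<rho> p sums_single)
  moreover have "a * p ^ 0 + of_real \<rho> * (1 / (1 - of_real \<rho> * p)\<^sup>2) + 1 / (1 - p)\<^sup>2 + d * p ^ 1 =
      covariance_kernel \<rho> s2 \<kappa> p"
    by (simp add: covariance_kernel_def a_def d_def)
  moreover have "(\<lambda>l. (if l = 0 then a * p ^ l else 0) + of_real \<rho> * (of_nat (Suc l) * (of_real \<rho> * p) ^ l) + of_nat (Suc l) * p ^ l
      + (if l = 1 then d * p ^ l else 0)) = (\<lambda>l. kernel_coeff \<rho> s2 \<kappa> l * p ^ l)"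
    by (rule ext) (simp add: kernel_coeff_def a_def d_def algebra_simps)
  ultimately show ?thesis by simp
qed

lemma holomorphic_on_covariance_kernel:
  assumes \<rho>: "\<bar>\<rho>\<bar> \<le> 1" shows "covariance_kernel \<rho> s2 \<kappa> holomorphic_on ball 0 1"
proof (rule power_series_holomorphic)
  fix p :: complex assume "p \<in> ball 0 1"
  then show "(\<lambda>l. kernel_coeff \<rho> s2 \<kappa> l * (p - 0) ^ l) sums covariance_kernel \<rho> s2 \<kappa> p"
    using covariance_kernel_sums[OF \<rho>] by simp
qed

text \<open>
  Summation and integration are interchanged by uniform convergence. This is done on a circle
  and not on the boundary contour, because a piecewise continuously differentiable path may have unbounded
  derivative near its exceptional points.
\<close>

lemma contour_integral_circle_power_series:
  assumes r: "0 < r" and G: "continuous_on (sphere 0 r) G"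
    and c: "summable (\<lambda>l. norm (c l) * r ^ l)"
    and S: "\<And>t. t \<in> sphere 0 r \<Longrightarrow> (\<lambda>l. c l * t ^ l) sums S t"
  shows "(\<lambda>l. c l * contour_integral (circlepath 0 r) (\<lambda>t. t ^ l * G t)) sums
         contour_integral (circlepath 0 r) (\<lambda>t. G t * S t)"
proof -
  have circ: "path_image (circlepath 0 r) = sphere 0 r" using r by simp
  have int: "(\<lambda>t. t ^ l * G t) contour_integrable_on circlepath 0 r" for l
    by (rule contour_integrable_continuous_circlepath, unfold circ) (intro continuous_intros G)
  have "bounded (G ` sphere 0 r)" by (intro compact_imp_bounded compact_continuous_image G) simp
  then obtain B where "\<forall>x\<in>G ` sphere 0 r. norm x \<le> B" unfolding bounded_iff ..
  then have B: "norm (G t) \<le> B" if "t \<in> sphere 0 r" for t using that by blast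
  have M: "summable (\<lambda>l. norm (c l) * r ^ l * B)" by (intro summable_mult2 c)
  have ul: "uniform_limit (sphere 0 r) (\<lambda>n t. \<Sum>l<n. c l * (t ^ l * G t)) (\<lambda>t. suminf (\<lambda>l. c l * (t ^ l * G t))) sequentially"
  proof (rule Weierstrass_m_test[OF _ M])
    fix l and t :: complex assume t: "t \<in> sphere 0 r"
    then have "norm t = r" by simp
    then have "norm (c l * (t ^ l * G t)) = norm (c l) * r ^ l * norm (G t)"
      by (simp add: norm_mult norm_power)
    also have "\<dots> \<le> norm (c l) * r ^ l * B" using B[OF t] r by (intro mult_left_mono) auto
    finally show "norm (c l * (t ^ l * G t)) \<le> norm (c l) * r ^ l * B" .
  qed
  have lim: "suminf (\<lambda>l. c l * (t ^ l * G t)) = G t * S t" if "t \<in> sphere 0 r" for t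
  proof -
    have "(\<lambda>l. G t * (c l * t ^ l)) sums (G t * S t)" by (rule sums_mult[OF S[OF that]])
    moreover have "(\<lambda>l. G t * (c l * t ^ l)) = (\<lambda>l. c l * (t ^ l * G t))" by (simp add: mult_ac)
    ultimately show ?thesis by (simp add: sums_iff)
  qed
  have ul': "uniform_limit (sphere 0 r) (\<lambda>n t. \<Sum>l<n. c l * (t ^ l * G t)) (\<lambda>t. G t * S t) sequentially"
    by (rule iffD1[OF uniform_limit_cong'[OF refl lim] ul])
  have lint: "(\<lambda>t. c l * (t ^ l * G t)) contour_integrable_on circlepath 0 r" for l
    by (rule contour_integrable_lmul[OF int])
  have sint: "\<forall>n. (\<lambda>t. \<Sum>l<n. c l * (t ^ l * G t)) contour_integrable_on circlepath 0 r"
    by (intro allI contour_integrable_sum lint finite_lessThan)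
  have "(\<lambda>n. contour_integral (circlepath 0 r) (\<lambda>t. \<Sum>l<n. c l * (t ^ l * G t)))
      \<longlonglongrightarrow> contour_integral (circlepath 0 r) (\<lambda>t. G t * S t)"
    by (rule contour_integral_uniform_limit_circlepath(2)[OF always_eventually[OF sint] ul' sequentially_bot r])
  moreover have "contour_integral (circlepath 0 r) (\<lambda>t. \<Sum>l<n. c l * (t ^ l * G t)) =
      (\<Sum>l<n. c l * contour_integral (circlepath 0 r) (\<lambda>t. t ^ l * G t))" for n
  proof -
    have "contour_integral (circlepath 0 r) (\<lambda>t. \<Sum>l<n. c l * (t ^ l * G t)) =
        (\<Sum>l<n. contour_integral (circlepath 0 r) (\<lambda>t. c l * (t ^ l * G t)))"
      by (rule contour_integral_sum[OF finite_lessThan lint])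
    then show ?thesis using int by (simp only: contour_integral_lmul)
  qed
  ultimately show ?thesis by (simp add: sums_def)
qed

section \<open>Chebyshev polynomials on the parametrized exterior\<close>

lemma chebyshev_T_rec:
  "chebyshev_T 0 x = 1" "chebyshev_T (Suc 0) x = x"
  "chebyshev_T (Suc (Suc n)) x = 2 * x * chebyshev_T (Suc n) x - chebyshev_T n x"
proof -
  define D where "D = 1 - 2 * fps_const x * fps_X + fps_X ^ 2"
  define A where "A = (1 - fps_const x * fps_X) / D"
  have T: "chebyshev_T n x = fps_nth A n" for n by (simp add: chebyshev_T_def A_def D_def)
  have D0: "fps_nth D 0 \<noteq> 0" by (simp add: D_def)
  have "A * D = 1 - fps_const x * fps_X"
    unfolding A_def using D0 by (simp add: fps_divide_unit mult.assoc inverse_mult_eq_1)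
  then have "A - fps_const (2 * x) * (fps_X * A) + fps_X * (fps_X * A) = 1 - fps_const x * fps_X"
    by (simp add: D_def algebra_simps power2_eq_square numeral_fps_const flip: fps_const_mult)
  then have *: "fps_nth (A - fps_const (2 * x) * (fps_X * A) + fps_X * (fps_X * A)) n = fps_nth (1 - fps_const x * fps_X) n" for n
    by simp
  show "chebyshev_T 0 x = 1" using *[of 0] by (simp add: T)
  then show "chebyshev_T (Suc 0) x = x" using *[of 1] by (simp add: T)
  have "fps_nth A (Suc (Suc n)) - 2 * x * fps_nth A (Suc n) + fps_nth A n = 0"
    using *[of "Suc (Suc n)"] by simp
  then show "chebyshev_T (Suc (Suc n)) x = 2 * x * chebyshev_T (Suc n) x - chebyshev_T n x"
    by (simp add: T algebra_simps)
qed

lemma holomorphic_on_chebyshev_T: "chebyshev_T j holomorphic_on A"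
proof -
  have "chebyshev_T j holomorphic_on A \<and> chebyshev_T (Suc j) holomorphic_on A"
    by (induction j) (auto simp: chebyshev_T_rec[abs_def] intro!: holomorphic_intros)
  then show ?thesis ..
qed

text \<open>
  The identity \<open>2 cos (j \<theta>) = exp (\<i> j \<theta>) + exp (- \<i> j \<theta>)\<close> in algebraic form, valid for complex \<open>\<theta>\<close>.
\<close>

lemma chebyshev_T_half_sum:
  assumes xy: "x * y = 1" shows "2 * chebyshev_T j ((x + y) / 2) = x ^ j + y ^ j"
proof -
  have "2 * chebyshev_T j ((x + y) / 2) = x ^ j + y ^ j \<and>
        2 * chebyshev_T (Suc j) ((x + y) / 2) = x ^ Suc j + y ^ Suc j"
  proof (induction j)
    case 0 then show ?case by (simp add: chebyshev_T_rec)
  next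
    case (Suc j)
    have "2 * chebyshev_T (Suc (Suc j)) ((x + y) / 2) =
        (x + y) * (2 * chebyshev_T (Suc j) ((x + y) / 2)) - 2 * chebyshev_T j ((x + y) / 2)"
      by (simp add: chebyshev_T_rec algebra_simps)
    also have "\<dots> = (x + y) * (x ^ Suc j + y ^ Suc j) - (x ^ j + y ^ j)" using Suc by simp
    also have "\<dots> = x ^ Suc (Suc j) + y ^ Suc (Suc j) + (x * y - 1) * (x ^ j + y ^ j)"
      by (simp add: algebra_simps)
    finally show ?case using Suc xy by simp
  qed
  then show ?thesis ..
qed

text \<open>
  In the case excluded here, \<open>\<rho> = 0\<close> and \<open>j = 0\<close>, the left side is \<open>1\<close> and the right side is \<open>2\<close>; both
  are constants, on which all coefficients \<open>a\<^sub>l\<close> vanish.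
\<close>

lemma F_fun_joukowski:
  assumes s: "s \<noteq> 0" and "\<rho> \<noteq> 0 \<or> j \<noteq> 0"
  shows "F_fun \<rho> j (joukowski \<rho> s) = of_real \<rho> ^ j * s ^ j + 1 / s ^ j"
proof (cases "\<rho> = 0")
  case True
  then show ?thesis using assms by (simp add: F_fun_def joukowski_def power_one_over)
next
  case False
  define c where "c = csqrt (of_real \<rho>)"
  have c: "c \<noteq> 0" "c * c = of_real \<rho>" using False power2_csqrt[of "of_real \<rho>"] by (auto simp: c_def power2_eq_square)
  have half: "joukowski \<rho> s / (2 * c) = (c * s + 1 / (c * s)) / 2"
    using s c by (simp add: joukowski_def field_simps flip: c(2))
  have "F_fun \<rho> j (joukowski \<rho> s) = c ^ j * (2 * chebyshev_T j (joukowski \<rho> s / (2 * c)))"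
    using False by (simp add: F_fun_def flip: c_def)
  also have "\<dots> = c ^ j * ((c * s) ^ j + (1 / (c * s)) ^ j)"
    unfolding half using s c by (subst chebyshev_T_half_sum) auto
  also have "\<dots> = (c * c) ^ j * s ^ j + 1 / s ^ j"
    using s c(1) by (simp add: power_mult_distrib field_simps)
  finally show ?thesis by (simp add: c(2))
qed

lemma holomorphic_on_F_fun: "F_fun \<rho> j holomorphic_on A"
proof (cases "\<rho> = 0")
  case True
  then have "F_fun \<rho> j = (\<lambda>z. z ^ j)" by (auto simp: F_fun_def)
  then show ?thesis by (auto intro!: holomorphic_intros)
next
  case False
  then have "F_fun \<rho> j = (\<lambda>z. 2 * csqrt (of_real \<rho>) ^ j * (chebyshev_T j \<circ> (\<lambda>z. z / (2 * csqrt (of_real \<rho>)))) z)"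
    by (auto simp: F_fun_def)
  then show ?thesis using False
    by (auto intro!: holomorphic_intros holomorphic_on_compose holomorphic_on_chebyshev_T simp del: o_apply)
qed

lemma has_contour_integral_circle_Laurent_monomial:
  assumes r: "0 < r"
  shows "((\<lambda>s. s ^ l * (1 / s ^ j)) has_contour_integral (if j = Suc l then 2 * of_real pi * \<i> else 0)) (circlepath 0 r)"
proof (cases "j \<le> l")
  case True
  have "((\<lambda>s. s ^ (l - j)) has_contour_integral 0) (circlepath 0 r)"
    by (rule Cauchy_theorem_disc_simple[of _ 0 "r + 1"]) (use r in \<open>auto intro!: holomorphic_intros\<close>)
  then have "((\<lambda>s. s ^ l * (1 / s ^ j)) has_contour_integral 0) (circlepath 0 r)"
    by (rule has_contour_integral_eq) (use r True in \<open>auto simp: power_diff\<close>)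
  then show ?thesis using True by simp
next
  case False
  then obtain k where k: "j = l + Suc k" by (metis add_Suc_right less_imp_Suc_add not_le)
  have "((\<lambda>u. 1 / (u - 0) ^ Suc k) has_contour_integral (2 * pi * \<i>) / fact k * (deriv ^^ k) (\<lambda>_. 1) 0) (circlepath 0 r)"
    by (rule Cauchy_has_contour_integral_higher_derivative_circlepath) (use r in auto)
  also have "(2 * pi * \<i>) / fact k * (deriv ^^ k) (\<lambda>_. 1) (0::complex) = (if j = Suc l then 2 * of_real pi * \<i> else 0)"
    using k by simp
  finally show ?thesis
    by (rule has_contour_integral_eq) (use r k in \<open>auto simp: power_add\<close>)
qed

text \<open>
  After the substitution, the integrand is \<open>s\<^sup>l (\<rho>\<^sup>j s\<^sup>j + s\<^sup>-\<^sup>j)\<close>, and only a term \<open>1 / s\<close> has a nonzero integral: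
  the \<open>F\<^sub>j\<close> are dual to the coefficients \<open>a\<^sub>l\<close>.
\<close>

lemma coeff_a_F_fun:
  assumes r: "0 < r"
  shows "coeff_a \<rho> r (Suc l) (F_fun \<rho> j) = (if j = Suc l then 1 else 0)"
proof -
  have "((\<lambda>s. s ^ l * F_fun \<rho> j (joukowski \<rho> s)) has_contour_integral 
      (if j = Suc l then 2 * of_real pi * \<i> else 0)) (circlepath 0 r)"
  proof (cases "\<rho> \<noteq> 0 \<or> j \<noteq> 0")
    case True
    have "((\<lambda>s. of_real \<rho> ^ j * (s ^ (l + j) * (1 / s ^ 0)) + s ^ l * (1 / s ^ j)) has_contour_integral
       of_real \<rho> ^ j * (if 0 = Suc (l + j) then 2 * of_real pi * \<i> else 0) + (if j = Suc l then 2 * of_real pi * \<i> else 0)) (circlepath 0 r)"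
      by (intro has_contour_integral_add has_contour_integral_lmul has_contour_integral_circle_Laurent_monomial r)
    then have "((\<lambda>s. of_real \<rho> ^ j * (s ^ (l + j) * (1 / s ^ 0)) + s ^ l * (1 / s ^ j)) has_contour_integral
       (if j = Suc l then 2 * of_real pi * \<i> else 0)) (circlepath 0 r)" by simp
    then show ?thesis
      by (rule has_contour_integral_eq)
         (use r True in \<open>auto simp: F_fun_joukowski power_add algebra_simps\<close>)
  next
    case False
    then have "F_fun \<rho> j = (\<lambda>_. 1)" by (auto simp: F_fun_def)
    then show ?thesis using has_contour_integral_circle_Laurent_monomial[OF r, of l 0] False by simp
  qed
  then show ?thesis by (auto simp: coeff_a_def joukowski_def dest!: contour_integral_unique)
qed

section \<open>The correlation of the atoms\<close>

text \<open>
  Unit variances make the squares integrable, since a non-integrable function has integral \<open>0\<close>; the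
  bound is then \<open>\<bar>x y\<bar> \<le> (x\<^sup>2 + y\<^sup>2) / 2\<close>.
\<close>

lemma abs_correlation_le_1:
  assumes "atom_variables M X1 X2 Z \<sigma>"
  shows "\<bar>prob_space.expectation M (\<lambda>\<omega>. X1 \<omega> * X2 \<omega>)\<bar> \<le> 1"
proof -
  have X: "X1 \<in> borel_measurable M" "X2 \<in> borel_measurable M"
    and E: "(LINT \<omega>|M. (X1 \<omega>)\<^sup>2) = 1" "(LINT \<omega>|M. (X2 \<omega>)\<^sup>2) = 1"
    using assms by (auto simp: atom_variables_def)
  have int: "integrable M (\<lambda>\<omega>. (X1 \<omega>)\<^sup>2)" "integrable M (\<lambda>\<omega>. (X2 \<omega>)\<^sup>2)"
    using E not_integrable_integral_eq by fastforce+
  have le: "\<bar>x * y\<bar> \<le> (x\<^sup>2 + y\<^sup>2) / 2" for x y :: real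
    using sum_squares_bound[of "\<bar>x\<bar>" "\<bar>y\<bar>"] by (simp add: abs_mult)
  have i2: "integrable M (\<lambda>\<omega>. ((X1 \<omega>)\<^sup>2 + (X2 \<omega>)\<^sup>2) / 2)" using int by simp
  have "integrable M (\<lambda>\<omega>. X1 \<omega> * X2 \<omega>)"
    by (rule Bochner_Integration.integrable_bound[OF i2]) (use X le in \<open>auto intro!: AE_I2 order_trans[OF le] simp: abs_mult\<close>)
  then have "\<bar>LINT \<omega>|M. X1 \<omega> * X2 \<omega>\<bar> \<le> (LINT \<omega>|M. ((X1 \<omega>)\<^sup>2 + (X2 \<omega>)\<^sup>2) / 2)"
    using i2 le by (intro order_trans[OF integral_abs_bound] integral_mono) auto
  also have "\<dots> = 1" using int E by simp
  finally show ?thesis .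
qed

section \<open>The covariance as a series\<close>

lemma contour_integral_power_joukowski:
  "contour_integral (circlepath 0 r) (\<lambda>s. s ^ l * f (joukowski \<rho> s)) = 2 * of_real pi * \<i> * coeff_a \<rho> r (Suc l) f"
  by (simp add: coeff_a_def joukowski_def)

text \<open>
  Both integrations are moved to the circle, first in \<open>w\<close> for fixed \<open>z\<close> and then in \<open>z\<close>. The inner integral
  is \<open>f(z) m'(z) Q(- m(z))\<close> up to sign with a power series \<open>Q\<close>, so it is again holomorphic outside the
  ellipse and the deformation applies a second time. The signs \<open>\<eta>\<close> and \<open>m'(z) dz = - ds\<close> each occur twice.
\<close>

lemma G_covariance_sums:
  assumes \<rho>: "\<bar>\<rho>\<bar> \<le> 1" and \<delta>: "\<delta> > 0" and r: "0 < r" "r < 1" "1 / r - r \<le> \<delta>"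
    and C: "boundary_contour \<rho> \<delta> C"
    and U: "open U" "ellipsoid_nbhd \<rho> \<delta> \<subseteq> U" and f: "f holomorphic_on U" and g: "g holomorphic_on U"
  shows "(\<lambda>l. kernel_coeff \<rho> s2 \<kappa> l * coeff_a \<rho> r (Suc l) f * coeff_a \<rho> r (Suc l) g)
           sums G_covariance C \<rho> s2 \<kappa> f g"
proof -
  let ?E = "closed_ellipse \<rho>" and ?K = "ellipsoid_nbhd \<rho> \<delta>" and ?m = "m_fun \<rho>" and ?\<phi> = "joukowski \<rho>"
  let ?k = "kernel_coeff \<rho> s2 \<kappa>" and ?ker = "covariance_kernel \<rho> s2 \<kappa>" and ?circ = "circlepath 0 r"
  let ?\<upsilon> = "upsilon_fun \<rho> s2 \<kappa>"
  define b where "b = (\<lambda>l h. contour_integral ?circ (\<lambda>s. s ^ l * h (?\<phi> s)))"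
  \<comment> \<open>The inner integral, as a function of \<open>p = - m(z)\<close>.\<close>
  define Q where "Q = (\<lambda>p. contour_integral ?circ (\<lambda>t. g (?\<phi> t) * ?ker (p * t)))"
  obtain \<eta> :: complex where \<eta>: "\<eta>\<^sup>2 = 1" and deform: "h holomorphic_on U - ?E \<Longrightarrow>
       contour_integral C h = \<eta> * contour_integral ?circ (\<lambda>s. h (?\<phi> s) * deriv ?\<phi> s)" for h
    using boundary_contour_integral_eq_circle[OF \<rho> \<delta> r C] U by blast
  have sphere: "s \<noteq> 0" "cmod s < 1" "cmod s = r" "?\<phi> s \<notin> ?E" "?\<phi> s \<in> U" if "s \<in> sphere 0 r" for s
  proof -
    show s: "s \<noteq> 0" "cmod s < 1" "cmod s = r" using that r by auto
    show "?\<phi> s \<notin> ?E" by (rule joukowski_notin_closed_ellipse[OF \<rho> s(1,2)])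
    have "?\<phi> s \<in> ?K" by (rule joukowski_annulus_in_nbhd[OF \<rho> r(1,3)]) (use s in simp_all)
    then show "?\<phi> s \<in> U" using U(2) by blast
  qed
  have circ: "path_image ?circ = sphere 0 r" using r by simp
  have imC: "z \<notin> ?E" if "z \<in> path_image C" for z
  proof -
    have "infdist z ?E = \<delta>" 
      using C that by (intro frontier_ellipsoid_nbhd[OF \<rho>]) (simp add: boundary_contour_def)
    then show ?thesis using \<delta> by auto
  qed
  have D: "open (- ?E)" using compact_closed_ellipse compact_imp_closed by blast
  have mD: "?m holomorphic_on U - ?E" "deriv ?m holomorphic_on U - ?E"
    using holomorphic_on_m_fun[OF \<rho>] holomorphic_deriv[OF holomorphic_on_m_fun[OF \<rho>] D] 
    by (auto intro: holomorphic_on_subset)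
  have fg: "f holomorphic_on U - ?E" "g holomorphic_on U - ?E" using f g by (auto intro: holomorphic_on_subset)
  have cont: "continuous_on (sphere 0 r) (\<lambda>s. h (?\<phi> s))" if h: "h holomorphic_on U" for h
  proof (rule continuous_on_compose2[where g = h and f = "?\<phi>" and t = U])
    show "continuous_on U h" using h by (rule holomorphic_on_imp_continuous_on)
    show "continuous_on (sphere 0 r) ?\<phi>"
      using r by (intro holomorphic_on_imp_continuous_on holomorphic_on_joukowski) simp
    show "?\<phi> ` sphere 0 r \<subseteq> U" using sphere(5) by blast
  qed

  have k_abs: "summable (\<lambda>l. norm (?k l * x ^ l))" if x1: "cmod x < 1" for x
  proof -
    obtain y where y: "cmod x < y" "y < 1" using dense[OF x1] by blast
    have y0: "0 < y" using y norm_ge_zero[of x] by linarith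
    have "summable (\<lambda>l. ?k l * of_real y ^ l)"
      by (rule sums_summable[OF covariance_kernel_sums[OF \<rho>]]) (use y y0 in simp)
    then show ?thesis by (rule powser_insidea) (use y y0 in simp)
  qed
  have Q_sums: "(\<lambda>l. ?k l * b l g * p ^ l) sums Q p" if p: "cmod p \<le> 1" for p
  proof -
    have pt: "cmod (p * t) < 1" if "cmod t = r" for t
    proof -
      have "cmod p * r \<le> 1 * r" using p r by (intro mult_right_mono) auto
      then have "cmod p * r < 1" using r(2) by linarith
      then show ?thesis using that by (simp add: norm_mult)
    qed
    have "(\<lambda>l. ?k l * p ^ l * contour_integral ?circ (\<lambda>t. t ^ l * g (?\<phi> t))) sums Q p"
      unfolding Q_def
    proof (rule contour_integral_circle_power_series[OF r(1) cont[OF g]])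
      have "summable (\<lambda>l. norm (?k l * (p * of_real r) ^ l))" using pt[of "of_real r"] r by (intro k_abs) auto
      then show "summable (\<lambda>l. norm (?k l * p ^ l) * r ^ l)" 
        using r by (simp add: norm_mult norm_power power_mult_distrib mult_ac)
      fix t :: complex assume "t \<in> sphere 0 r"
      then show "(\<lambda>l. ?k l * p ^ l * t ^ l) sums ?ker (p * t)"
        using covariance_kernel_sums[OF \<rho> pt, of t s2 \<kappa>] by (simp add: power_mult_distrib mult_ac)
    qed
    then show ?thesis by (simp add: b_def mult_ac)
  qed
  have Q_hol: "Q holomorphic_on ball 0 1"
    by (rule power_series_holomorphic[where a = "\<lambda>l. ?k l * b l g"]) (use Q_sums in auto)

  have \<upsilon>_circle: "?\<upsilon> z (?\<phi> t) * deriv ?\<phi> t = - (deriv ?m z * ?ker (- ?m z * t))" if z: "z \<notin> ?E" and t: "t \<in> sphere 0 r" for z t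
  proof -
    have "?\<upsilon> z (?\<phi> t) * deriv ?\<phi> t = deriv ?m z * (deriv ?m (?\<phi> t) * deriv ?\<phi> t) * ?ker (?m z * ?m (?\<phi> t))"
      using z sphere[OF t] by (simp add: upsilon_fun_eq_kernel[OF \<rho>])
    then show ?thesis using sphere[OF t] by (simp add: deriv_m_fun_joukowski[OF \<rho>] m_fun_joukowski[OF \<rho>])
  qed
  have inner: "contour_integral C (\<lambda>w. f z * g w * ?\<upsilon> z w) = - \<eta> * (f z * deriv ?m z * Q (- ?m z))"
    if z: "z \<notin> ?E" for z
  proof -
    have mm: "cmod (?m z * ?m w) < 1" if "w \<notin> ?E" for w
    proof -
      have "cmod (?m z) * cmod (?m w) < 1 * 1"
        using m_fun_outside(2)[OF \<rho>] that z by (intro mult_strict_mono) auto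
      then show ?thesis by (simp add: norm_mult)
    qed
    have "(\<lambda>w. ?ker (?m z * ?m w)) holomorphic_on U - ?E"
      using mm by (intro holomorphic_on_compose_gen[OF _ holomorphic_on_covariance_kernel[OF \<rho>], unfolded o_def] 
          holomorphic_intros mD) auto
    then have "(\<lambda>w. f z * g w * (deriv ?m z * deriv ?m w * ?ker (?m z * ?m w))) holomorphic_on U - ?E"
      by (intro holomorphic_intros fg mD)
    then have "(\<lambda>w. f z * g w * ?\<upsilon> z w) holomorphic_on U - ?E"
      by (rule holomorphic_transform) (use z in \<open>simp add: upsilon_fun_eq_kernel[OF \<rho>]\<close>)
    then have "contour_integral C (\<lambda>w. f z * g w * ?\<upsilon> z w) = 
        \<eta> * contour_integral ?circ (\<lambda>t. f z * g (?\<phi> t) * ?\<upsilon> z (?\<phi> t) * deriv ?\<phi> t)"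
      by (rule deform)
    also have "contour_integral ?circ (\<lambda>t. f z * g (?\<phi> t) * ?\<upsilon> z (?\<phi> t) * deriv ?\<phi> t) =
        contour_integral ?circ (\<lambda>t. - (f z * deriv ?m z) * (g (?\<phi> t) * ?ker (- ?m z * t)))"
    proof (rule contour_integral_eq)
      fix t assume "t \<in> path_image ?circ"
      then have "?\<upsilon> z (?\<phi> t) * deriv ?\<phi> t = - (deriv ?m z * ?ker (- ?m z * t))" using \<upsilon>_circle[OF z] circ by blast
      then show "f z * g (?\<phi> t) * ?\<upsilon> z (?\<phi> t) * deriv ?\<phi> t = - (f z * deriv ?m z) * (g (?\<phi> t) * ?ker (- ?m z * t))"
        by (simp add: mult.assoc)
    qed
    also have "\<dots> = - (f z * deriv ?m z) * Q (- ?m z)"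
      unfolding Q_def
    proof (rule contour_integral_lmul, rule contour_integrable_continuous_circlepath)
      have mt: "- ?m z * t \<in> ball 0 1" if "t \<in> sphere 0 r" for t
      proof -
        have "cmod (?m z) * r < 1 * 1"
          using m_fun_outside(2)[OF \<rho> z] r by (intro mult_strict_mono) auto
        then show ?thesis using that by (simp add: norm_mult)
      qed
      show "continuous_on (path_image ?circ) (\<lambda>t. g (?\<phi> t) * ?ker (- ?m z * t))"
        unfolding circ
        by (intro continuous_on_mult cont g 
            continuous_on_compose2[OF holomorphic_on_imp_continuous_on[OF holomorphic_on_covariance_kernel[OF \<rho>]]] continuous_intros)
           (use mt in blast)
    qed
    finally show ?thesis by simp
  qed
  have "contour_integral C (\<lambda>z. contour_integral C (\<lambda>w. f z * g w * ?\<upsilon> z w)) =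
      contour_integral C (\<lambda>z. - \<eta> * (f z * deriv ?m z * Q (- ?m z)))"
    by (rule contour_integral_eq) (rule inner[OF imC])
  also have "\<dots> = \<eta> * contour_integral ?circ (\<lambda>s. - \<eta> * (f (?\<phi> s) * deriv ?m (?\<phi> s) * Q (- ?m (?\<phi> s))) * deriv ?\<phi> s)"
  proof (rule deform)
    have "(\<lambda>z. Q (- ?m z)) holomorphic_on U - ?E"
      using m_fun_outside(2)[OF \<rho>] by (intro holomorphic_on_compose_gen[OF _ Q_hol, unfolded o_def] holomorphic_intros mD) auto
    then show "(\<lambda>z. - \<eta> * (f z * deriv ?m z * Q (- ?m z))) holomorphic_on U - ?E"
      by (intro holomorphic_intros fg mD)
  qed
  also have "contour_integral ?circ (\<lambda>s. - \<eta> * (f (?\<phi> s) * deriv ?m (?\<phi> s) * Q (- ?m (?\<phi> s))) * deriv ?\<phi> s) =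
      contour_integral ?circ (\<lambda>s. \<eta> * (f (?\<phi> s) * Q s))"
  proof (rule contour_integral_eq)
    fix s assume "s \<in> path_image ?circ"
    then have s: "s \<in> sphere 0 r" using circ by blast
    have "- \<eta> * (f (?\<phi> s) * deriv ?m (?\<phi> s) * Q (- ?m (?\<phi> s))) * deriv ?\<phi> s =
        - \<eta> * f (?\<phi> s) * Q (- ?m (?\<phi> s)) * (deriv ?m (?\<phi> s) * deriv ?\<phi> s)" by (simp add: mult_ac)
    also have "\<dots> = \<eta> * (f (?\<phi> s) * Q s)"
      using sphere[OF s] by (simp add: deriv_m_fun_joukowski[OF \<rho>] m_fun_joukowski[OF \<rho>])
    finally show "- \<eta> * (f (?\<phi> s) * deriv ?m (?\<phi> s) * Q (- ?m (?\<phi> s))) * deriv ?\<phi> s = \<eta> * (f (?\<phi> s) * Q s)" .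
  qed
  also have "\<dots> = \<eta> * contour_integral ?circ (\<lambda>s. f (?\<phi> s) * Q s)"
  proof (rule contour_integral_lmul, rule contour_integrable_continuous_circlepath)
    show "continuous_on (path_image ?circ) (\<lambda>s. f (?\<phi> s) * Q s)"
      unfolding circ 
      by (intro continuous_on_mult cont f continuous_on_subset[OF holomorphic_on_imp_continuous_on[OF Q_hol]])
         (use r in auto)
  qed
  finally have double: "contour_integral C (\<lambda>z. contour_integral C (\<lambda>w. f z * g w * ?\<upsilon> z w)) =
      contour_integral ?circ (\<lambda>s. f (?\<phi> s) * Q s)"
    using \<eta> by (simp add: power2_eq_square flip: mult.assoc)

  have bl: "contour_integral ?circ (\<lambda>s. s ^ l * h (?\<phi> s)) = b l h" for l h by (simp add: b_def)
  have "(\<lambda>l. ?k l * b l g * contour_integral ?circ (\<lambda>s. s ^ l * f (?\<phi> s))) sums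
      contour_integral ?circ (\<lambda>s. f (?\<phi> s) * Q s)"
  proof (rule contour_integral_circle_power_series[OF r(1) cont[OF f]])
    show "(\<lambda>l. ?k l * b l g * s ^ l) sums Q s" if "s \<in> sphere 0 r" for s
      using Q_sums[of s] sphere(2)[OF that] by simp
    \<comment> \<open>Convergence of \<open>Q\<close> at the boundary point \<open>1\<close> gives absolute convergence on the circle of radius \<open>r < 1\<close>.\<close>
    have "summable (\<lambda>l. ?k l * b l g * 1 ^ l)" by (rule sums_summable[OF Q_sums]) simp
    then have "summable (\<lambda>l. norm (?k l * b l g * of_real r ^ l))"
      by (rule powser_insidea) (use r in simp)
    then show "summable (\<lambda>l. norm (?k l * b l g) * r ^ l)"
      using r by (simp add: norm_mult norm_power)
  qed
  then have "(\<lambda>l. ?k l * b l g * b l f) sums contour_integral ?circ (\<lambda>s. f (?\<phi> s) * Q s)"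
    unfolding bl .
  then have "(\<lambda>l. - 1 / (4 * of_real pi ^ 2) * (?k l * b l g * b l f)) sums G_covariance C \<rho> s2 \<kappa> f g"
    unfolding G_covariance_def double by (rule sums_mult)
  moreover have "- 1 / (4 * of_real pi ^ 2) * (?k l * b l g * b l f) =
      ?k l * coeff_a \<rho> r (Suc l) f * coeff_a \<rho> r (Suc l) g" for l
    by (simp add: b_def contour_integral_power_joukowski power2_eq_square mult_ac)
  ultimately show ?thesis by simp
qed

lemma G_covariance_expansion:
  assumes "\<bar>\<rho>\<bar> \<le> 1" "\<delta> > 0" "0 < r" "r < 1" "1 / r - r \<le> \<delta>" "boundary_contour \<rho> \<delta> C"
    and f: "test_function \<rho> \<delta> f" and g: "test_function \<rho> \<delta> g"
  shows "summable (\<lambda>l. of_nat (Suc l) * (1 + of_real \<rho> ^ Suc l) * coeff_a \<rho> r (Suc l) f * coeff_a \<rho> r (Suc l) g)"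
    and "G_covariance C \<rho> s2 \<kappa> f g =
      of_real (s2 - \<rho> - 1) * coeff_a \<rho> r 1 f * coeff_a \<rho> r 1 g
      + 2 * of_real (\<kappa> - 2 * \<rho>\<^sup>2 - 1) * coeff_a \<rho> r 2 f * coeff_a \<rho> r 2 g
      + (\<Sum>l. of_nat (Suc l) * (1 + of_real \<rho> ^ Suc l) * coeff_a \<rho> r (Suc l) f * coeff_a \<rho> r (Suc l) g)"
proof -
  let ?t = "\<lambda>l. of_nat (Suc l) * (1 + of_real \<rho> ^ Suc l) * coeff_a \<rho> r (Suc l) f * coeff_a \<rho> r (Suc l) g"
  let ?p = "\<lambda>l. coeff_a \<rho> r (Suc l) f * coeff_a \<rho> r (Suc l) g"
  define a d :: complex where "a = of_real (s2 - \<rho> - 1)" and "d = of_real (2 * (\<kappa> - 2 * \<rho>\<^sup>2 - 1))"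
  obtain U V where U: "open U" "ellipsoid_nbhd \<rho> \<delta> \<subseteq> U" "f holomorphic_on U"
    and V: "open V" "ellipsoid_nbhd \<rho> \<delta> \<subseteq> V" "g holomorphic_on V"
    using f g by (auto simp: test_function_def)
  have "(\<lambda>l. kernel_coeff \<rho> s2 \<kappa> l * coeff_a \<rho> r (Suc l) f * coeff_a \<rho> r (Suc l) g)
           sums G_covariance C \<rho> s2 \<kappa> f g"
    by (rule G_covariance_sums[OF assms(1-6), of "U \<inter> V"]) (use U V in \<open>auto intro: holomorphic_on_subset\<close>)
  then have "(\<lambda>l. kernel_coeff \<rho> s2 \<kappa> l * coeff_a \<rho> r (Suc l) f * coeff_a \<rho> r (Suc l) g
        - (if l = 0 then a * ?p l else 0) - (if l = 1 then d * ?p l else 0)) sums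
      (G_covariance C \<rho> s2 \<kappa> f g - a * ?p 0 - d * ?p 1)"
    by (intro sums_diff sums_single)
  moreover have "kernel_coeff \<rho> s2 \<kappa> l * coeff_a \<rho> r (Suc l) f * coeff_a \<rho> r (Suc l) g
        - (if l = 0 then a * ?p l else 0) - (if l = 1 then d * ?p l else 0) = ?t l" for l
    by (simp add: kernel_coeff_def a_def d_def algebra_simps)
  ultimately have t: "?t sums (G_covariance C \<rho> s2 \<kappa> f g - a * ?p 0 - d * ?p 1)" by simp
  then show "summable ?t" by (rule sums_summable)
  have "suminf ?t = G_covariance C \<rho> s2 \<kappa> f g - a * ?p 0 - d * ?p 1" using sums_unique[OF t] by simp
  then show "G_covariance C \<rho> s2 \<kappa> f g =
      of_real (s2 - \<rho> - 1) * coeff_a \<rho> r 1 f * coeff_a \<rho> r 1 g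
      + 2 * of_real (\<kappa> - 2 * \<rho>\<^sup>2 - 1) * coeff_a \<rho> r 2 f * coeff_a \<rho> r 2 g + suminf ?t"
    by (simp add: a_def d_def eval_nat_numeral algebra_simps)
qed

lemma G_covariance_F_fun:
  assumes "\<bar>\<rho>\<bar> \<le> 1" "\<delta> > 0" "0 < r" "r < 1" "1 / r - r \<le> \<delta>" "boundary_contour \<rho> \<delta> C"
  shows "G_covariance C \<rho> s2 \<kappa> (F_fun \<rho> j) (F_fun \<rho> k) =
            of_real (if j = k then
                       (if j = 1 then s2 - \<rho> - 1 else 0)
                       + (if j = 2 then 2 * (\<kappa> - 2 * \<rho>\<^sup>2 - 1) else 0)
                       + real j * (1 + \<rho> ^ j)
                     else 0)"
proof -
  have s: "(\<lambda>l. kernel_coeff \<rho> s2 \<kappa> l * (if j = Suc l then 1 else 0) * (if k = Suc l then 1 else 0))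
      sums G_covariance C \<rho> s2 \<kappa> (F_fun \<rho> j) (F_fun \<rho> k)"
    using G_covariance_sums[OF assms, of UNIV "F_fun \<rho> j" "F_fun \<rho> k" s2 \<kappa>]
    by (simp add: holomorphic_on_F_fun coeff_a_F_fun[OF assms(3)])
  show ?thesis
  proof (cases "j = k \<and> j \<noteq> 0")
    case True
    then obtain i where i: "j = Suc i" "k = Suc i" by (metis not0_implies_Suc)
    have "(\<lambda>l. kernel_coeff \<rho> s2 \<kappa> l * (if j = Suc l then 1 else 0) * (if k = Suc l then 1 else 0)) =
       (\<lambda>l. if l = i then kernel_coeff \<rho> s2 \<kappa> l else 0)" by (auto simp: i)
    then have "G_covariance C \<rho> s2 \<kappa> (F_fun \<rho> j) (F_fun \<rho> k) = kernel_coeff \<rho> s2 \<kappa> i"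
      using s sums_single[of i "kernel_coeff \<rho> s2 \<kappa>"] sums_unique2 by metis
    then show ?thesis by (auto simp: i kernel_coeff_def)
  next
    case False
    then have "(\<lambda>l. kernel_coeff \<rho> s2 \<kappa> l * (if j = Suc l then 1 else 0) * (if k = Suc l then 1 else 0)) = (\<lambda>l. 0)"
      by auto
    then have "G_covariance C \<rho> s2 \<kappa> (F_fun \<rho> j) (F_fun \<rho> k) = 0"
      using s sums_zero sums_unique2 by metis
    then show ?thesis using False by auto
  qed
qed

theorem proposition2p8:
  fixes \<delta> :: real
  assumes "\<delta> > 0"
  shows "\<exists>r::real. 0 < r \<and> r < 1 \<and>
    (\<forall>(M :: 'a measure) \<xi>1 \<xi>2 \<zeta> \<sigma> (P :: nat \<Rightarrow> 'b measure) Y \<rho> \<kappa> C.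
       atom_variables M \<xi>1 \<xi>2 \<zeta> \<sigma> \<and>
       (\<forall>N\<ge>1. real_elliptic_random_matrix (P N) N (Y N) M \<xi>1 \<xi>2 \<zeta>) \<and>
       \<rho> = prob_space.expectation M (\<lambda>\<omega>. \<xi>1 \<omega> * \<xi>2 \<omega>) \<and>
       \<kappa> = prob_space.expectation M (\<lambda>\<omega>. (\<xi>1 \<omega>)\<^sup>2 * (\<xi>2 \<omega>)\<^sup>2) \<and>
       boundary_contour \<rho> \<delta> C \<longrightarrow>
       (\<forall>(k::nat) f. (\<forall>j\<in>{1..k}. test_function \<rho> \<delta> (f j)) \<longrightarrow>
          (\<forall>i\<in>{1..k}. \<forall>j\<in>{1..k}.
             summable (\<lambda>l. of_nat (Suc l) * (1 + of_real \<rho> ^ Suc l) *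
                           coeff_a \<rho> r (Suc l) (f i) * coeff_a \<rho> r (Suc l) (f j)) \<and>
             G_covariance C \<rho> (\<sigma>\<^sup>2) \<kappa> (f i) (f j) =
               of_real (\<sigma>\<^sup>2 - \<rho> - 1) * coeff_a \<rho> r 1 (f i) * coeff_a \<rho> r 1 (f j)
               + 2 * of_real (\<kappa> - 2 * \<rho>\<^sup>2 - 1) * coeff_a \<rho> r 2 (f i) * coeff_a \<rho> r 2 (f j)
               + (\<Sum>l. of_nat (Suc l) * (1 + of_real \<rho> ^ Suc l) *
                       coeff_a \<rho> r (Suc l) (f i) * coeff_a \<rho> r (Suc l) (f j)))) \<and>
       (\<forall>j k :: nat.
          G_covariance C \<rho> (\<sigma>\<^sup>2) \<kappa> (F_fun \<rho> j) (F_fun \<rho> k) =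
            of_real (if j = k then
                       (if j = 1 then \<sigma>\<^sup>2 - \<rho> - 1 else 0)
                       + (if j = 2 then 2 * (\<kappa> - 2 * \<rho>\<^sup>2 - 1) else 0)
                       + real j * (1 + \<rho> ^ j)
                     else 0)))"
proof -
  \<comment> \<open>For this radius \<open>1 / r - r < \<delta>\<close>, so the annulus \<open>r \<le> \<bar>s\<bar> \<le> 1\<close> is mapped into the neighbourhood for all \<open>\<rho>\<close>.\<close>
  define r where "r = 1 / (1 + \<delta> / 2)"
  have r: "0 < r" "r < 1" using assms by (auto simp: r_def)
  have "1 / r \<le> 1 + \<delta> / 2" "1 - r \<le> \<delta> / 2"
    using assms by (simp_all add: r_def field_simps)
  then have r\<delta>: "1 / r - r \<le> \<delta>" by linarith
  show ?thesis
  proof (intro exI[of _ r] conjI allI impI ballI r; elim conjE)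
    fix M :: "'a measure" and \<xi>1 \<xi>2 \<zeta> \<sigma> \<rho> \<kappa> C and k :: nat and f :: "nat \<Rightarrow> complex \<Rightarrow> complex" and i j
    assume "atom_variables M \<xi>1 \<xi>2 \<zeta> \<sigma>" "\<rho> = prob_space.expectation M (\<lambda>\<omega>. \<xi>1 \<omega> * \<xi>2 \<omega>)"
      and C: "boundary_contour \<rho> \<delta> C"
      and f: "\<forall>j\<in>{1..k}. test_function \<rho> \<delta> (f j)" "i \<in> {1..k}" "j \<in> {1..k}"
    then have \<rho>: "\<bar>\<rho>\<bar> \<le> 1" using abs_correlation_le_1 by blast
    note * = G_covariance_expansion[OF \<rho> assms r r\<delta> C, of "f i" "f j"]
    show "summable (\<lambda>l. of_nat (Suc l) * (1 + of_real \<rho> ^ Suc l) *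
                           coeff_a \<rho> r (Suc l) (f i) * coeff_a \<rho> r (Suc l) (f j))"
      using * f by blast
    show "G_covariance C \<rho> (\<sigma>\<^sup>2) \<kappa> (f i) (f j) =
               of_real (\<sigma>\<^sup>2 - \<rho> - 1) * coeff_a \<rho> r 1 (f i) * coeff_a \<rho> r 1 (f j)
               + 2 * of_real (\<kappa> - 2 * \<rho>\<^sup>2 - 1) * coeff_a \<rho> r 2 (f i) * coeff_a \<rho> r 2 (f j)
               + (\<Sum>l. of_nat (Suc l) * (1 + of_real \<rho> ^ Suc l) *
                       coeff_a \<rho> r (Suc l) (f i) * coeff_a \<rho> r (Suc l) (f j))"
      using * f by blast
  next
    fix M :: "'a measure" and \<xi>1 \<xi>2 \<zeta> \<sigma> \<rho> \<kappa> C j k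
    assume "atom_variables M \<xi>1 \<xi>2 \<zeta> \<sigma>" "\<rho> = prob_space.expectation M (\<lambda>\<omega>. \<xi>1 \<omega> * \<xi>2 \<omega>)"
      and C: "boundary_contour \<rho> \<delta> C"
    then have \<rho>: "\<bar>\<rho>\<bar> \<le> 1" using abs_correlation_le_1 by blast
    show "G_covariance C \<rho> (\<sigma>\<^sup>2) \<kappa> (F_fun \<rho> j) (F_fun \<rho> k) =
            of_real (if j = k then
                       (if j = 1 then \<sigma>\<^sup>2 - \<rho> - 1 else 0)
                       + (if j = 2 then 2 * (\<kappa> - 2 * \<rho>\<^sup>2 - 1) else 0)
                       + real j * (1 + \<rho> ^ j)
                     else 0)"
      by (rule G_covariance_F_fun[OF \<rho> assms r r\<delta> C])
  qed
qed

end
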